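(* Let $\mathcal H=GL(n,\mathbb C)\times\mathfrak h_{ss}$, where $\mathfrak h_{ss}$ is the space of diagonal matrices $L=\mathrm{diag}(\lambda_1,\dots,\lambda_n)$ with distinct eigenvalues, with the Poisson structure whose only nonzero brackets between entries of $G$ and the $\lambda_\ell$ are $$\{G_{bj},G_{c\ell}\}=\frac{G_{b\ell}G_{cj}}{\lambda_j-\lambda_\ell}\quad(j\neq\ell),\qquad \{G_{bk},\lambda_\ell\}=-G_{bk}\,\delta_{\ell k}.$$ Then the map $(G,L)\mapsto A=GLG^{-1}$ is a Poisson morphism between this Poisson structure and the Kirillov–Kostant Poisson structure $$\{\mathrm{tr}(AF),\mathrm{tr}(AH)\}_{KK}=\mathrm{tr}\big(A[H,F]\big),\qquad\forall F,H\in\mathfrak{gl}_n\simeq\mathfrak{gl}_n^\vee,$$ or, equivalently, $\{\overset1A,\overset2A\}=[\overset1A,P]$.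
   Context: $\overset1M=M\otimes\mathbf 1$, $\overset2M=\mathbf 1\otimes M$, $\{\overset1X,\overset2Y\}=\sum\{X_{ab},Y_{cd}\}E_{ab}\otimes E_{cd}$, and $P=\sum_{i,j}E_{ij}\otimes E_{ji}$ is the $n^2\times n^2$ permutation matrix ($P(u\otimes v)=v\otimes u$). $F$ and $H$ are constant matrices; $\mathfrak{gl}_n$ is identified with its dual by the trace pairing. *)

theory Defs
  imports "HOL-Analysis.Analysis"
begin

section \<open>Holomorphic Poisson structures on open subsets of complex coordinate space\<close>

text \<open>Everything lives on open subsets of \<open>complex ^ 'i\<close>, where \<open>'i\<close> indexes the coordinates.
  A function is holomorphic on an open set if its total derivative exists there and is
  complex linear.\<close>

definition holo_on :: "(complex ^ 'i \<Rightarrow> complex) \<Rightarrow> (complex ^ 'i) set \<Rightarrow> bool" where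
  "holo_on f U \<longleftrightarrow>
     (\<forall>x\<in>U. \<exists>d :: complex ^ 'i. (f has_derivative (\<lambda>v. \<Sum>i\<in>UNIV. d $ i * v $ i)) (at x))"

definition cpartial :: "'i \<Rightarrow> (complex ^ 'i \<Rightarrow> complex) \<Rightarrow> complex ^ 'i \<Rightarrow> complex" where
  "cpartial i f x = deriv (\<lambda>t. f (x + t *s axis i 1)) 0"

text \<open>A bivector field is given by its matrix of components \<open>\<pi> x $ i $ j = {x\<^sub>i, x\<^sub>j}\<close>.\<close>

type_synonym 'i bivector = "complex ^ 'i \<Rightarrow> complex ^ 'i ^ 'i"

definition pbracket ::
  "'i bivector \<Rightarrow> (complex ^ 'i \<Rightarrow> complex) \<Rightarrow> (complex ^ 'i \<Rightarrow> complex) \<Rightarrow> complex ^ 'i \<Rightarrow> complex"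
  where
  "pbracket \<pi> f g x = (\<Sum>i\<in>UNIV. \<Sum>j\<in>UNIV. \<pi> x $ i $ j * cpartial i f x * cpartial j g x)"

definition poisson_structure :: "(complex ^ 'i) set \<Rightarrow> 'i bivector \<Rightarrow> bool" where
  "poisson_structure M \<pi> \<longleftrightarrow>
     open M \<and>
     (\<forall>i j. holo_on (\<lambda>x. \<pi> x $ i $ j) M) \<and>
     (\<forall>x\<in>M. \<forall>i j. \<pi> x $ i $ j = - \<pi> x $ j $ i) \<and>
     (\<forall>U f g h. open U \<and> U \<subseteq> M \<and> holo_on f U \<and> holo_on g U \<and> holo_on h U \<longrightarrow>
        (\<forall>x\<in>U. pbracket \<pi> f (pbracket \<pi> g h) x + pbracket \<pi> g (pbracket \<pi> h f) x
                + pbracket \<pi> h (pbracket \<pi> f g) x = 0))"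

definition poisson_morphism ::
  "(complex ^ 'i) set \<Rightarrow> 'i bivector \<Rightarrow> (complex ^ 'j) set \<Rightarrow> 'j bivector
     \<Rightarrow> (complex ^ 'i \<Rightarrow> complex ^ 'j) \<Rightarrow> bool" where
  "poisson_morphism M \<pi> N \<rho> \<phi> \<longleftrightarrow>
     poisson_structure M \<pi> \<and> poisson_structure N \<rho> \<and>
     \<phi> ` M \<subseteq> N \<and> (\<forall>j. holo_on (\<lambda>x. \<phi> x $ j) M) \<and>
     (\<forall>V f g. open V \<and> V \<subseteq> N \<and> holo_on f V \<and> holo_on g V \<longrightarrow>
        (\<forall>x \<in> M \<inter> \<phi> -` V. pbracket \<pi> (f \<circ> \<phi>) (g \<circ> \<phi>) x = pbracket \<rho> f g (\<phi> x)))"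


section \<open>Matrices and tensor notation\<close>

text \<open>The space of \<open>n \<times> n\<close> matrices as a coordinate space with coordinates indexed by pairs.\<close>

definition mat_of :: "complex ^ ('n \<times> 'n) \<Rightarrow> complex ^ 'n ^ 'n" where
  "mat_of a = (\<chi> i j. a $ (i, j))"

definition vec_of :: "complex ^ 'n ^ 'n \<Rightarrow> complex ^ ('n \<times> 'n)" where
  "vec_of A = (\<chi> p. A $ fst p $ snd p)"

definition Emat :: "'n \<Rightarrow> 'n \<Rightarrow> complex ^ 'n ^ 'n" where
  "Emat i j = (\<chi> a b. if a = i \<and> b = j then 1 else 0)"

definition msmult :: "complex \<Rightarrow> complex ^ 'm ^ 'k \<Rightarrow> complex ^ 'm ^ 'k" where
  "msmult c M = (\<chi> p q. c * M $ p $ q)"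

text \<open>Kronecker product, the matrix of \<open>X \<otimes> Y\<close>.\<close>

definition kron ::
  "complex ^ 'n ^ 'n \<Rightarrow> complex ^ 'n ^ 'n \<Rightarrow> complex ^ ('n \<times> 'n) ^ ('n \<times> 'n)" where
  "kron X Y = (\<chi> p q. X $ fst p $ fst q * Y $ snd p $ snd q)"

definition Pmat :: "complex ^ ('n::finite \<times> 'n) ^ ('n \<times> 'n)" where
  "Pmat = (\<Sum>i\<in>UNIV. \<Sum>j\<in>UNIV. kron (Emat i j) (Emat j i))"

definition commutator :: "complex ^ 'm ^ 'm \<Rightarrow> complex ^ 'm ^ 'm \<Rightarrow> complex ^ 'm ^ 'm" where
  "commutator X Y = X ** Y - Y ** X"

text \<open>The tensor bracket of two matrix-valued functions: superscript 1 on \<open>X\<close>, 2 on \<open>Y\<close>.\<close>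

definition tensor_bracket ::
  "'i bivector \<Rightarrow> (complex ^ 'i \<Rightarrow> complex ^ 'n ^ 'n) \<Rightarrow> (complex ^ 'i \<Rightarrow> complex ^ 'n ^ 'n)
     \<Rightarrow> complex ^ 'i \<Rightarrow> complex ^ ('n \<times> 'n) ^ ('n \<times> 'n)" where
  "tensor_bracket \<pi> X Y x =
     (\<Sum>a\<in>UNIV. \<Sum>b\<in>UNIV. \<Sum>c\<in>UNIV. \<Sum>d\<in>UNIV.
        msmult (pbracket \<pi> (\<lambda>y. X y $ a $ b) (\<lambda>y. Y y $ c $ d) x) (kron (Emat a b) (Emat c d)))"


section \<open>The two Poisson structures and the map between them\<close>

definition kirillov_kostant :: "('n::finite \<times> 'n) bivector \<Rightarrow> bool" where
  "kirillov_kostant \<kappa> \<longleftrightarrow>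
     (\<forall>F H :: complex ^ 'n ^ 'n. \<forall>a.
        pbracket \<kappa> (\<lambda>y. trace (mat_of y ** F)) (\<lambda>y. trace (mat_of y ** H)) a
        = trace (mat_of a ** commutator H F))"

text \<open>A point \<open>x\<close> of \<open>GL(n) \<times> \<hh>\<^sub>s\<^sub>s\<close> has coordinates \<open>x $ Inl (b, j) = G\<^sub>b\<^sub>j\<close> and
  \<open>x $ Inr k = \<lambda>\<^sub>k\<close>.\<close>

definition Gmat :: "complex ^ (('n \<times> 'n) + 'n) \<Rightarrow> complex ^ 'n ^ 'n" where
  "Gmat x = (\<chi> i j. x $ Inl (i, j))"

definition Lmat :: "complex ^ (('n \<times> 'n) + 'n) \<Rightarrow> complex ^ 'n ^ 'n" where
  "Lmat x = (\<chi> i j. if i = j then x $ Inr i else 0)"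

definition GL_hss :: "(complex ^ (('n::finite \<times> 'n) + 'n)) set" where
  "GL_hss = {x. invertible (Gmat x) \<and> inj (\<lambda>k. x $ Inr k)}"

definition GL_hss_bivector :: "(('n::finite \<times> 'n) + 'n) bivector" where
  "GL_hss_bivector x = (\<chi> p q. case (p, q) of
       (Inl (b, j), Inl (c, l)) \<Rightarrow>
          if j = l then 0
          else x $ Inl (b, l) * x $ Inl (c, j) / (x $ Inr j - x $ Inr l)
     | (Inl (b, k), Inr l) \<Rightarrow> if l = k then - x $ Inl (b, k) else 0
     | (Inr l, Inl (b, k)) \<Rightarrow> if l = k then x $ Inl (b, k) else 0
     | (Inr k, Inr l) \<Rightarrow> 0)"

definition adj_map :: "complex ^ (('n::finite \<times> 'n) + 'n) \<Rightarrow> complex ^ ('n \<times> 'n)" where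
  "adj_map x = vec_of (Gmat x ** Lmat x ** matrix_inv (Gmat x))"

end

theory Submission
  imports Defs "HOL-Complex_Analysis.Cauchy_Integral_Formula"
begin

text \<open>The heart of the matter is that the entries of \<open>A = G L G\<^sup>-\<^sup>1\<close> generate left multiplication on
\<open>GL\<close>: the Hamiltonian vector field of \<open>A\<^sub>a\<^sub>b\<close> moves \<open>G\<close> in the direction \<open>E\<^sub>b\<^sub>a G\<close> and leaves the
eigenvalues \<open>\<lambda>\<^sub>k\<close> fixed (\<open>ham_adj_map\<close>). Indeed, differentiating \<open>A G = G L\<close> in a direction \<open>V\<close> gives
\<open>dA[V] = (V\<^sub>G L + G V\<^sub>L - A V\<^sub>G) G\<^sup>-\<^sup>1\<close>; when \<open>V\<close> is a row of the bivector, \<open>A G = G L\<close> turns the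
combination \<open>V\<^sub>G L - A V\<^sub>G\<close> into a factor \<open>\<lambda>\<^sub>j - \<lambda>\<^sub>l\<close> that cancels the denominator of the bracket.
Inserting the direction \<open>E\<^sub>b\<^sub>a G\<close> into the same formula yields \<open>{A\<^sub>a\<^sub>b, A} = [E\<^sub>b\<^sub>a, A]\<close>, which is the
Kirillov--Kostant bracket of the coordinates (\<open>pbracket_adj_map\<close>). The chain rule extends the
equality from coordinates to all holomorphic functions (\<open>poisson_morphismI\<close>).

A Poisson morphism is a map between Poisson structures, so both bivectors must satisfy the Jacobi
identity for arbitrary locally defined holomorphic functions. In the Jacobiator the second
derivatives of the functions cancel by their symmetry, and what remains is trilinear in the first
derivatives; hence it suffices to check triples of coordinates (\<open>poisson_structureI\<close>).
For \<open>GL \<times> \<hh>\<^sub>s\<^sub>s\<close> the main case of this check is a partial fraction identity in the differences of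
the eigenvalues, for \<open>gl\<^sub>n\<close> it is a computation with Kronecker deltas.

The cancellation needs that a holomorphic function of several variables has holomorphic first
partial derivatives and symmetric second ones. Both follow from the Cauchy formula, which writes
\<open>\<partial>\<^sub>i f (x)\<close> as an average of \<open>f\<close> over a circle in the direction of the \<open>i\<close>-th axis: the average may
be differentiated under the integral sign, and averaging \<open>\<partial>\<^sub>j f\<close> in this way computes
\<open>\<partial>\<^sub>i (\<partial>\<^sub>j f)\<close> as well as \<open>\<partial>\<^sub>j (\<partial>\<^sub>i f)\<close>.

Finally, evaluating the trace formula on elementary matrices shows that a bivector is the
Kirillov--Kostant one if and only if its components are those of \<open>kk_bivector\<close>, and these are also the
entries of \<open>[A \<otimes> 1, P]\<close>; this gives uniqueness, existence and the tensor form of the bracket.\<close>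

section \<open>Complex linear total derivatives\<close>

text \<open>The derivative is kept as a linear map, not as a vector of partial derivatives: brackets are then
directional derivatives along Hamiltonian vector fields, and most of the index sums disappear.\<close>
definition has_cderiv ::
  "(complex ^ 'i \<Rightarrow> complex) \<Rightarrow> (complex ^ 'i \<Rightarrow> complex) \<Rightarrow> complex ^ 'i \<Rightarrow> bool" where
  "has_cderiv f D x \<longleftrightarrow> (f has_derivative D) (at x) \<and> (\<forall>c v. D (c *s v) = c * D v)"

lemma bounded_linear_vector_smult: "bounded_linear (\<lambda>t::complex. t *s (v :: complex ^ 'i::finite))"
  by (rule linear_conv_bounded_linear[THEN iffD1])
     (auto simp: linear_iff vec_eq_iff algebra_simps)

lemma has_cderiv_cpartial:
  assumes "has_cderiv f D (x :: complex ^ 'i::finite)"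
  shows "cpartial i f x = D (axis i 1)"
proof -
  have fD: "(f has_derivative D) (at x)" and Dc: "\<And>c v. D (c *s v) = c * D v"
    using assms by (auto simp: has_cderiv_def)
  have "((\<lambda>t::complex. x + t *s axis i 1) has_derivative (\<lambda>t. t *s axis i 1)) (at 0)"
    using bounded_linear_imp_has_derivative[OF bounded_linear_vector_smult[of "axis i 1"]]
    by (auto intro!: derivative_eq_intros)
  moreover have "(f has_derivative D) (at (x + (0::complex) *s axis i 1))"
    using fD by simp
  ultimately have "((\<lambda>t. f (x + t *s axis i 1)) has_derivative (\<lambda>t. D (t *s axis i 1))) (at 0)"
    by (rule has_derivative_compose)
  then have "((\<lambda>t. f (x + t *s axis i 1)) has_field_derivative D (axis i 1)) (at 0)"
    by (simp add: Dc has_field_derivative_def mult_commute_abs)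
  then show ?thesis
    unfolding cpartial_def by (rule DERIV_imp_deriv)
qed

text \<open>In particular a complex linear derivative is determined by the partial derivatives, hence unique.\<close>
lemma has_cderiv_expand:
  assumes "has_cderiv f D (x :: complex ^ 'i::finite)"
  shows "D v = (\<Sum>i\<in>UNIV. cpartial i f x * v $ i)"
proof -
  have lin: "linear D" and Dc: "\<And>c v. D (c *s v) = c * D v"
    using assms has_derivative_linear by (auto simp: has_cderiv_def)
  have "D v = D (\<Sum>i\<in>UNIV. v $ i *s axis i 1)"
    by (simp add: basis_expansion)
  also have "\<dots> = (\<Sum>i\<in>UNIV. v $ i * D (axis i 1))"
    by (simp add: linear_sum[OF lin] Dc)
  finally show ?thesis
    by (simp add: has_cderiv_cpartial[OF assms] mult.commute)
qed

lemma holo_on_iff: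
  "holo_on f U \<longleftrightarrow> (\<forall>x\<in>U. \<exists>D. has_cderiv f D (x :: complex ^ 'i::finite))"
proof
  assume "holo_on f U"
  then show "\<forall>x\<in>U. \<exists>D. has_cderiv f D x"
    unfolding holo_on_def has_cderiv_def
  proof (intro ballI)
    fix x assume "\<forall>x\<in>U. \<exists>d. (f has_derivative (\<lambda>v. \<Sum>i\<in>UNIV. d $ i * v $ i)) (at x)" "x \<in> U"
    then obtain d where "(f has_derivative (\<lambda>v. \<Sum>i\<in>UNIV. d $ i * v $ i)) (at x)"
      by blast
    then show "\<exists>D. (f has_derivative D) (at x) \<and> (\<forall>c v. D (c *s v) = c * D v)"
      by (intro exI[of _ "\<lambda>v. \<Sum>i\<in>UNIV. d $ i * v $ i"])
         (simp add: sum_distrib_left mult.left_commute)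
  qed
next
  assume R: "\<forall>x\<in>U. \<exists>D. has_cderiv f D x"
  show "holo_on f U"
    unfolding holo_on_def
  proof
    fix x assume "x \<in> U"
    with R obtain D where D: "has_cderiv f D x" by blast
    have "D = (\<lambda>v. \<Sum>i\<in>UNIV. (\<chi> i. cpartial i f x) $ i * v $ i)"
      using has_cderiv_expand[OF D] by (simp add: fun_eq_iff)
    with D have "(f has_derivative (\<lambda>v. \<Sum>i\<in>UNIV. (\<chi> i. cpartial i f x) $ i * v $ i)) (at x)"
      by (simp add: has_cderiv_def)
    then show "\<exists>d. (f has_derivative (\<lambda>v. \<Sum>i\<in>UNIV. d $ i * v $ i)) (at x)"
      by (rule exI)
  qed
qed

lemma holo_on_has_cderiv:
  assumes "holo_on f U" "x \<in> U"
  shows "has_cderiv f (\<lambda>v. \<Sum>i\<in>UNIV. cpartial i f x * v $ i) (x :: complex ^ 'i::finite)"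
proof -
  obtain D where D: "has_cderiv f D x"
    using assms holo_on_iff by blast
  moreover have "D = (\<lambda>v. \<Sum>i\<in>UNIV. cpartial i f x * v $ i)"
    using has_cderiv_expand[OF D] by (simp add: fun_eq_iff)
  ultimately show ?thesis by simp
qed

lemma holo_onI: "(\<And>x. x \<in> U \<Longrightarrow> has_cderiv f (D x) (x :: complex ^ 'i::finite)) \<Longrightarrow> holo_on f U"
  using holo_on_iff by blast

lemma holo_on_continuous: "holo_on f U \<Longrightarrow> continuous_on U (f :: complex ^ 'i::finite \<Rightarrow> complex)"
  by (intro continuous_at_imp_continuous_on ballI)
     (auto simp: holo_on_def dest: has_derivative_continuous)

lemma has_cderiv_unique:
  assumes "has_cderiv f D (x :: complex ^ 'i::finite)" "has_cderiv f D' x"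
  shows "D v = D' v"
  using has_cderiv_expand[OF assms(1)] has_cderiv_expand[OF assms(2)] by simp

lemma has_cderiv_const: "has_cderiv (\<lambda>x. c) (\<lambda>v. 0) (x :: complex ^ 'i::finite)"
  by (simp add: has_cderiv_def)

lemma has_cderiv_coord: "has_cderiv (\<lambda>x. x $ i) (\<lambda>v. v $ i) (x :: complex ^ 'i::finite)"
  by (auto simp: has_cderiv_def intro: bounded_linear_imp_has_derivative bounded_linear_vec_nth)

lemma has_cderiv_diff:
  "has_cderiv f D x \<Longrightarrow> has_cderiv g E x \<Longrightarrow>
     has_cderiv (\<lambda>x. f x - g x) (\<lambda>v. D v - E v) (x :: complex ^ 'i::finite)"
  by (auto simp: has_cderiv_def algebra_simps intro: has_derivative_diff)

lemma has_cderiv_minus: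
  "has_cderiv f D x \<Longrightarrow> has_cderiv (\<lambda>x. - f x) (\<lambda>v. - D v) (x :: complex ^ 'i::finite)"
  by (auto simp: has_cderiv_def algebra_simps intro: has_derivative_minus)

lemma has_cderiv_mult:
  "has_cderiv f D x \<Longrightarrow> has_cderiv g E x \<Longrightarrow>
     has_cderiv (\<lambda>x. f x * g x) (\<lambda>v. f x * E v + D v * g x) (x :: complex ^ 'i::finite)"
  by (auto simp: has_cderiv_def algebra_simps dest: has_derivative_mult)

lemma has_cderiv_divide:
  "has_cderiv f D x \<Longrightarrow> has_cderiv g E x \<Longrightarrow> g x \<noteq> 0 \<Longrightarrow>
     has_cderiv (\<lambda>x. f x / g x) (\<lambda>v. (D v * g x - f x * E v) / (g x * g x)) (x :: complex ^ 'i::finite)"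
  by (auto simp: has_cderiv_def field_simps dest: has_derivative_divide')

lemma has_cderiv_if:
  "(P \<Longrightarrow> has_cderiv f D x) \<Longrightarrow> (\<not> P \<Longrightarrow> has_cderiv g E x) \<Longrightarrow>
     has_cderiv (\<lambda>x. if P then f x else g x) (\<lambda>v. if P then D v else E v) (x :: complex ^ 'i::finite)"
  by (cases P) simp_all

lemma has_cderiv_sum:
  "(\<And>k. k \<in> K \<Longrightarrow> has_cderiv (f k) (D k) x) \<Longrightarrow>
     has_cderiv (\<lambda>x. \<Sum>k\<in>K. f k x) (\<lambda>v. \<Sum>k\<in>K. D k v) (x :: complex ^ 'i::finite)"
  by (auto simp: has_cderiv_def sum_distrib_left intro!: has_derivative_sum)

lemma has_cderiv_transform:
  assumes "has_cderiv f D (x :: complex ^ 'i::finite)" "open U" "x \<in> U"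
    and "\<And>y. y \<in> U \<Longrightarrow> f y = g y"
  shows "has_cderiv g D x"
  using assms unfolding has_cderiv_def
  by (blast intro: has_derivative_transform_within_open)

lemma holo_on_transform:
  assumes "open U" "holo_on f (U :: (complex ^ 'i::finite) set)" "\<And>y. y \<in> U \<Longrightarrow> f y = g y"
  shows "holo_on g U"
proof (rule holo_onI)
  fix x assume "x \<in> U"
  then show "has_cderiv g (\<lambda>v. \<Sum>i\<in>UNIV. cpartial i f x * v $ i) x"
    using assms by (intro has_cderiv_transform[OF holo_on_has_cderiv[OF assms(2)] assms(1)]) auto
qed

lemma holo_on_const: "holo_on (\<lambda>x. c) (U :: (complex ^ 'i::finite) set)"
  by (rule holo_onI[OF has_cderiv_const])

lemma holo_on_coord: "holo_on (\<lambda>x. x $ i) (U :: (complex ^ 'i::finite) set)"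
  by (rule holo_onI[OF has_cderiv_coord])

lemma holo_on_mult:
  "holo_on f U \<Longrightarrow> holo_on g U \<Longrightarrow> holo_on (\<lambda>x. f x * g x) (U :: (complex ^ 'i::finite) set)"
  by (rule holo_onI, rule has_cderiv_mult) (auto intro: holo_on_has_cderiv)

lemma holo_on_divide:
  "holo_on f U \<Longrightarrow> holo_on g U \<Longrightarrow> (\<And>x. x \<in> U \<Longrightarrow> g x \<noteq> 0) \<Longrightarrow>
     holo_on (\<lambda>x. f x / g x) (U :: (complex ^ 'i::finite) set)"
  by (rule holo_onI, rule has_cderiv_divide) (auto intro: holo_on_has_cderiv)

lemma holo_on_sum:
  assumes "\<And>k. k \<in> K \<Longrightarrow> holo_on (f k) U"
  shows "holo_on (\<lambda>x. \<Sum>k\<in>K. f k x) (U :: (complex ^ 'i::finite) set)"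
  by (rule holo_onI, rule has_cderiv_sum, rule holo_on_has_cderiv[OF assms])

lemma holo_on_prod:
  assumes "finite K" "\<And>k. k \<in> K \<Longrightarrow> holo_on (f k) U"
  shows "holo_on (\<lambda>x. \<Prod>k\<in>K. f k x) (U :: (complex ^ 'i::finite) set)"
  using assms by (induction K rule: finite_induct) (auto intro: holo_on_const holo_on_mult)

lemma has_cderiv_chain:
  fixes \<phi> :: "complex ^ 'i::finite \<Rightarrow> complex ^ 'j::finite"
  assumes f: "has_cderiv f D (\<phi> x)" and \<phi>: "\<And>j. has_cderiv (\<lambda>x. \<phi> x $ j) (\<lambda>v. \<Phi> v $ j) x"
  shows "has_cderiv (f \<circ> \<phi>) (\<lambda>v. D (\<Phi> v)) x"
proof -
  have "((\<lambda>x. \<phi> x \<bullet> b) has_derivative (\<lambda>v. \<Phi> v \<bullet> b)) (at x)" if bB: "b \<in> Basis" for b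
  proof -
    obtain j u where b: "b = axis j u"
      using bB by (auto simp: Basis_vec_def)
    have "((\<lambda>x. \<phi> x $ j \<bullet> u) has_derivative (\<lambda>v. \<Phi> v $ j \<bullet> u)) (at x)"
      using \<phi>[of j] by (auto simp: has_cderiv_def intro: has_derivative_inner_left)
    then show ?thesis by (simp add: b inner_axis)
  qed
  then have "(\<phi> has_derivative \<Phi>) (at x)"
    by (simp add: has_derivative_componentwise_within[of \<phi>])
  then have "((\<lambda>x. f (\<phi> x)) has_derivative (\<lambda>v. D (\<Phi> v))) (at x)"
    using f by (auto simp: has_cderiv_def intro: has_derivative_compose)
  moreover have "\<Phi> (c *s v) = c *s \<Phi> v" for c v
    using \<phi> by (auto simp: has_cderiv_def vec_eq_iff)
  ultimately show ?thesis
    using f by (simp add: has_cderiv_def comp_def)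
qed

section \<open>Partial derivatives of holomorphic functions\<close>
definition circ :: "real \<Rightarrow> real \<Rightarrow> complex" where
  "circ r t = of_real r * exp (2 * of_real pi * \<i> * of_real t)"

lemma circ_nonzero: "r > 0 \<Longrightarrow> circ r t \<noteq> 0"
  by (simp add: circ_def)

lemma norm_circ: "r > 0 \<Longrightarrow> norm (circ r t) = r"
  by (simp add: circ_def norm_mult)

lemma continuous_on_circ [continuous_intros]:
  "continuous_on A g \<Longrightarrow> continuous_on A (\<lambda>t. circ r (g t))"
  unfolding circ_def by (intro continuous_intros)

text \<open>Cauchy's formula for the first derivative, with \<open>du = 2 \<pi> \<i> u dt\<close> along \<open>u = circ r t\<close>: this
cancels one power of \<open>u\<close> in the kernel \<open>1 / u\<^sup>2\<close> together with the factor \<open>2 \<pi> \<i>\<close>.\<close>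
lemma deriv_circle_average:
  assumes r: "r > 0" and c: "continuous_on (cball 0 r) \<phi>" and h: "\<phi> holomorphic_on ball 0 r"
  shows "deriv \<phi> 0 = integral {0..1} (\<lambda>t. \<phi> (circ r t) / circ r t)"
proof -
  have "((\<lambda>u. \<phi> u / (u - 0) ^ Suc 1) has_contour_integral
          (2 * pi * \<i>) / fact 1 * (deriv ^^ 1) \<phi> 0) (circlepath 0 r)"
    using r by (intro Cauchy_has_contour_integral_higher_derivative_circlepath c h) simp
  then have "((\<lambda>t. \<phi> (circlepath 0 r t) / (circlepath 0 r t)\<^sup>2
            * vector_derivative (circlepath 0 r) (at t within {0..1}))
          has_integral 2 * pi * \<i> * deriv \<phi> 0) {0..1}"
    by (simp add: has_contour_integral_def power2_eq_square)
  moreover have "\<phi> (circlepath 0 r t) / (circlepath 0 r t)\<^sup>2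
            * vector_derivative (circlepath 0 r) (at t within {0..1})
          = 2 * pi * \<i> * (\<phi> (circ r t) / circ r t)" if "t \<in> {0..1}" for t
  proof -
    have "circlepath 0 r t = circ r t"
      by (simp add: circlepath circ_def)
    moreover have "vector_derivative (circlepath 0 r) (at t within {0..1}) = 2 * pi * \<i> * circ r t"
      using that by (simp add: vector_derivative_circlepath01 circ_def)
    ultimately show ?thesis
      using circ_nonzero[OF r, of t] by (simp add: field_simps power2_eq_square)
  qed
  ultimately have "((\<lambda>t. 2 * pi * \<i> * (\<phi> (circ r t) / circ r t))
          has_integral 2 * pi * \<i> * deriv \<phi> 0) {0..1}"
    by (rule has_integral_eq[rotated])
  from has_integral_mult_right[OF this, of "1 / (2 * pi * \<i>)"]
  have "((\<lambda>t. \<phi> (circ r t) / circ r t) has_integral deriv \<phi> 0) {0..1}"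
    by (simp add: mult.assoc)
  then show ?thesis by (simp add: integral_unique)
qed

lemma norm_smult_axis: "norm (u *s axis i (1 :: complex) :: complex ^ 'i::finite) = norm u"
proof -
  have "(\<Sum>j\<in>UNIV. (norm ((u *s axis i (1 :: complex) :: complex ^ 'i) $ j))\<^sup>2)
      = (\<Sum>j\<in>UNIV. if j = i then (norm u)\<^sup>2 else 0)"
    by (intro sum.cong) (auto simp: axis_def)
  then show ?thesis by (simp add: norm_vec_def L2_set_def)
qed

lemma cpartial_circle_average:
  fixes x :: "complex ^ 'i::finite"
  assumes f: "holo_on f U" and r: "r > 0" and sub: "cball x r \<subseteq> U"
  shows "cpartial i f x = integral {0..1} (\<lambda>t. f (x + circ r t *s axis i 1) / circ r t)"
proof -
  have inU: "x + u *s axis i 1 \<in> U" if "u \<in> cball 0 r" for u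
    using that sub by (auto simp: subset_iff dist_norm norm_smult_axis)
  have fd: "((\<lambda>u. f (x + u *s axis i 1)) has_field_derivative
        cpartial i f (x + u *s axis i 1)) (at u)" if "u \<in> cball 0 r" for u
  proof -
    have "((\<lambda>t. x + t *s axis i 1) has_derivative (\<lambda>t. t *s axis i 1)) (at u)"
      using bounded_linear_imp_has_derivative[OF bounded_linear_vector_smult[of "axis i 1"]]
      by (auto intro!: derivative_eq_intros)
    moreover have "(f has_derivative (\<lambda>v. \<Sum>j\<in>UNIV. cpartial j f (x + u *s axis i 1) * v $ j))
        (at (x + u *s axis i 1))"
      using holo_on_has_cderiv[OF f inU[OF that]] by (simp add: has_cderiv_def)
    ultimately have "((\<lambda>t. f (x + t *s axis i 1)) has_derivative
        (\<lambda>t. \<Sum>j\<in>UNIV. cpartial j f (x + u *s axis i 1) * (t *s axis i 1) $ j)) (at u)"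
      by (rule has_derivative_compose)
    then show ?thesis
      by (simp add: has_field_derivative_def axis_def if_distrib cong: if_cong)
  qed
  have "continuous_on (cball 0 r) (\<lambda>u. f (x + u *s axis i 1))"
    using fd by (intro continuous_at_imp_continuous_on ballI) (auto dest: DERIV_isCont)
  moreover have "(\<lambda>u. f (x + u *s axis i 1)) holomorphic_on ball 0 r"
    unfolding holomorphic_on_open[OF open_ball]
    by (intro ballI exI, rule fd) auto
  ultimately show ?thesis
    unfolding cpartial_def by (rule deriv_circle_average[OF r])
qed

text \<open>The joint continuity that is needed to differentiate the circle average under the integral.\<close>
lemma continuous_on_shifted:
  fixes g :: "complex ^ 'i::finite \<Rightarrow> complex"
  assumes "continuous_on (ball x (2 * r)) g" "r > 0"
  shows "continuous_on (ball x r \<times> cbox 0 1)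
           (\<lambda>(y, t). g (y + circ r t *s axis i 1) / circ r t)"
proof -
  have "continuous_on (ball x r \<times> cbox 0 1) (\<lambda>p. g (fst p + circ r (snd p) *s axis i 1))"
  proof (rule continuous_on_compose2[OF assms(1)])
    show "continuous_on (ball x r \<times> cbox 0 1) (\<lambda>p. fst p + circ r (snd p) *s axis i 1)"
      by (intro continuous_intros bounded_linear.continuous_on[OF bounded_linear_vector_smult])
    show "(\<lambda>p. fst p + circ r (snd p) *s axis i 1) ` (ball x r \<times> cbox 0 1) \<subseteq> ball x (2 * r)"
    proof clarsimp
      fix y t assume "dist x y < r"
      moreover have "dist x (y + circ r t *s axis i 1) \<le> dist x y + r"
        using norm_triangle_ineq4[of "x - y" "circ r t *s axis i 1"] assms(2)
        by (simp add: dist_norm norm_smult_axis norm_circ diff_diff_eq)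
      ultimately show "dist x (y + circ r t *s axis i 1) < 2 * r" by simp
    qed
  qed
  then show ?thesis
    unfolding split_beta
    by (intro continuous_intros) (use assms(2) in \<open>auto simp: circ_nonzero\<close>)
qed

lemma integrable_on_circle:
  fixes g :: "complex ^ 'i::finite \<Rightarrow> complex"
  assumes "continuous_on (ball x (2 * r)) g" "r > 0" "y \<in> ball x r"
  shows "(\<lambda>t. g (y + circ r t *s axis i 1) / circ r t) integrable_on cbox 0 1"
proof (rule integrable_continuous)
  have "continuous_on (cbox 0 1) (\<lambda>t. case (y, t) of (y, t) \<Rightarrow> g (y + circ r t *s axis i 1) / circ r t)"
    by (rule continuous_on_compose2[OF continuous_on_shifted[OF assms(1,2)]])
       (use assms(3) in \<open>auto intro!: continuous_intros\<close>)
  then show "continuous_on (cbox 0 1) (\<lambda>t. g (y + circ r t *s axis i 1) / circ r t)"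
    by simp
qed

text \<open>Differentiation under the integral sign needs continuous partial derivatives. They are continuous
because each of them is itself a circle average of the continuous function \<open>f\<close>. The circles around
points near \<open>x\<close> stay in the ball of radius \<open>2 r\<close>; continuity of the partial derivatives at a point of
that ball again uses \<open>f\<close> on a ball of radius \<open>2 r\<close> around the point, whence the radius \<open>4 r\<close>.\<close>
lemma cpartial_has_cderiv_circle_average:
  fixes x :: "complex ^ 'i::finite"
  assumes f: "holo_on f U" and r: "r > 0" and sub: "ball x (4 * r) \<subseteq> U"
  shows "has_cderiv (cpartial i f)
           (\<lambda>v. \<Sum>j\<in>UNIV. integral {0..1} (\<lambda>t. cpartial j f (x + circ r t *s axis i 1) / circ r t) * v $ j) x"
proof -
  have cball_sub: "cball y r \<subseteq> U" if "y \<in> ball x (2 * r)" for y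
  proof
    fix z assume "z \<in> cball y r"
    then have "dist x z < 4 * r"
      using that dist_triangle[of x z y] r by simp
    with sub show "z \<in> U" by auto
  qed
  have inU: "y + circ r t *s axis i 1 \<in> U" if "y \<in> ball x r" for y t
  proof -
    have "y + circ r t *s axis i 1 \<in> cball y r"
      using r by (simp add: dist_norm norm_smult_axis norm_circ)
    with that r cball_sub[of y] show ?thesis by auto
  qed
  have f_cont: "continuous_on (ball z (2 * r)) f" if "z \<in> ball x (2 * r)" for z
    using holo_on_continuous[OF f]
  proof (rule continuous_on_subset)
    show "ball z (2 * r) \<subseteq> U"
    proof
      fix y assume "y \<in> ball z (2 * r)"
      then have "dist x y < 4 * r"
        using that dist_triangle[of x y z] by simp
      with sub show "y \<in> U" by auto
    qed
  qed
  have p_cont: "continuous_on (ball x (2 * r)) (cpartial j f)" for j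
  proof (rule continuous_at_imp_continuous_on, rule ballI)
    fix z assume z: "z \<in> ball x (2 * r)"
    have "continuous_on (ball z r \<inter> ball x (2 * r))
        (\<lambda>y. integral (cbox 0 1) (\<lambda>t. f (y + circ r t *s axis j 1) / circ r t))"
      by (rule continuous_on_subset[OF integral_continuous_on_param
            [OF continuous_on_shifted[OF f_cont[OF z] r]]]) auto
    then have "continuous_on (ball z r \<inter> ball x (2 * r)) (cpartial j f)"
      by (rule continuous_on_eq)
         (auto simp: cpartial_circle_average[OF f r] cball_sub)
    then show "isCont (cpartial j f) z"
      using z r by (subst (asm) continuous_on_eq_continuous_at) auto
  qed
  define dF where "dF y t = Blinfun (\<lambda>v. \<Sum>j\<in>UNIV. cpartial j f (y + circ r t *s axis i 1) / circ r t * v $ j)"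
    for y t
  have dF: "blinfun_apply (dF y t) v
      = (\<Sum>j\<in>UNIV. cpartial j f (y + circ r t *s axis i 1) / circ r t * v $ j)" for y t v
    unfolding dF_def
    by (subst bounded_linear_Blinfun_apply)
       (intro bounded_linear_sum bounded_linear_const_mult bounded_linear_vec_nth, rule refl)
  have dF_cont: "continuous_on (ball x r \<times> cbox 0 1) (\<lambda>(y, t). dF y t)"
    unfolding split_beta
  proof (rule continuous_on_blinfun_componentwise)
    fix b :: "complex ^ 'i"
    show "continuous_on (ball x r \<times> cbox 0 1) (\<lambda>p. blinfun_apply (dF (fst p) (snd p)) b)"
      unfolding dF
      by (intro continuous_on_sum continuous_on_mult continuous_on_const
            continuous_on_shifted[OF p_cont r, unfolded split_beta])
  qed
  have d: "((\<lambda>y. integral (cbox 0 1) (\<lambda>t. f (y + circ r t *s axis i 1) / circ r t))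
      has_derivative integral (cbox 0 1) (dF x)) (at x within ball x r)"
  proof (rule leibniz_rule[OF _ _ dF_cont])
    fix y t assume y: "y \<in> ball x r"
    have "((\<lambda>y. f (y + circ r t *s axis i 1)) has_derivative
        (\<lambda>v. \<Sum>j\<in>UNIV. cpartial j f (y + circ r t *s axis i 1) * v $ j)) (at y within ball x r)"
      by (rule has_derivative_compose[where f = "\<lambda>y. y + circ r t *s axis i 1"])
         (use holo_on_has_cderiv[OF f inU[OF y, of t]] in
           \<open>auto simp: has_cderiv_def intro!: derivative_eq_intros\<close>)
    from has_derivative_mult_left[OF this, of "inverse (circ r t)"]
    show "((\<lambda>y. f (y + circ r t *s axis i 1) / circ r t) has_derivative blinfun_apply (dF y t))
        (at y within ball x r)"
      by (simp add: dF[abs_def] divide_inverse sum_distrib_left mult_ac)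
  next
    fix y assume y: "y \<in> ball x r"
    then show "(\<lambda>t. f (y + circ r t *s axis i 1) / circ r t) integrable_on cbox 0 1"
      using f_cont[of x] r by (intro integrable_on_circle) auto
  qed (use r in auto)
  have "continuous_on (cbox 0 1) (\<lambda>t. case (x, t) of (y, t) \<Rightarrow> dF y t)"
    by (rule continuous_on_compose2[OF dF_cont]) (use r in \<open>auto intro!: continuous_intros\<close>)
  then have dFx_cont: "continuous_on (cbox 0 1) (dF x)"
    by simp
  have p_int: "(\<lambda>t. cpartial j f (x + circ r t *s axis i 1) / circ r t) integrable_on cbox 0 1" for j
    using p_cont r by (intro integrable_on_circle) auto
  have D: "blinfun_apply (integral (cbox 0 1) (dF x)) v
      = (\<Sum>j\<in>UNIV. integral {0..1} (\<lambda>t. cpartial j f (x + circ r t *s axis i 1) / circ r t) * v $ j)" for v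
  proof -
    have "blinfun_apply (integral (cbox 0 1) (dF x)) v = integral (cbox 0 1) (\<lambda>t. blinfun_apply (dF x t) v)"
      by (rule blinfun_apply_integral[OF integrable_continuous[OF dFx_cont]])
    also have "\<dots> = (\<Sum>j\<in>UNIV. integral (cbox 0 1) (\<lambda>t. cpartial j f (x + circ r t *s axis i 1) / circ r t * v $ j))"
      unfolding dF by (rule integral_sum) (simp, rule integrable_on_mult_left[OF p_int])
    finally show ?thesis by (simp only: integral_mult_left cbox_interval)
  qed
  have "(cpartial i f has_derivative integral (cbox 0 1) (dF x)) (at x)"
  proof (rule has_derivative_transform_within_open)
    show "((\<lambda>y. integral (cbox 0 1) (\<lambda>t. f (y + circ r t *s axis i 1) / circ r t))
      has_derivative integral (cbox 0 1) (dF x)) (at x)"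
      using d r by (simp add: at_within_open[of x "ball x r"])
    show "integral (cbox 0 1) (\<lambda>t. f (y + circ r t *s axis i 1) / circ r t) = cpartial i f y"
      if "y \<in> ball x r" for y
      using that r by (simp add: cpartial_circle_average[OF f r] cball_sub)
  qed (use r in auto)
  moreover have "blinfun_apply (integral (cbox 0 1) (dF x)) =
    (\<lambda>v. \<Sum>j\<in>UNIV. integral {0..1} (\<lambda>t. cpartial j f (x + circ r t *s axis i 1) / circ r t) * v $ j)"
    using D by (simp add: fun_eq_iff)
  ultimately show ?thesis
    by (simp add: has_cderiv_def sum_distrib_left mult.left_commute)
qed

lemma open_ball_radius:
  assumes "open U" "x \<in> (U :: (complex ^ 'i::finite) set)"
  obtains r where "r > 0" "ball x (4 * r) \<subseteq> U"
proof -
  obtain e where "e > 0" "ball x e \<subseteq> U"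
    using assms open_contains_ball by blast
  then show thesis by (intro that[of "e / 4"]) auto
qed

lemma holo_on_cpartial:
  assumes "open U" "holo_on f (U :: (complex ^ 'i::finite) set)"
  shows "holo_on (cpartial i f) U"
  unfolding holo_on_iff
proof
  fix x assume "x \<in> U"
  then obtain r where "r > 0" "ball x (4 * r) \<subseteq> U"
    using open_ball_radius assms(1) by blast
  then show "\<exists>D. has_cderiv (cpartial i f) D x"
    using cpartial_has_cderiv_circle_average[OF assms(2)] by blast
qed

text \<open>Both sides are the average of \<open>\<partial>\<^sub>j f\<close> over a circle in the \<open>i\<close>-th direction: the left one by
differentiating the average of \<open>f\<close>, the right one by Cauchy's formula for the function \<open>\<partial>\<^sub>j f\<close>,
which is now known to be holomorphic.\<close>
lemma cpartial_commute:
  assumes "open U" "holo_on f (U :: (complex ^ 'i::finite) set)" "x \<in> U"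
  shows "cpartial j (cpartial i f) x = cpartial i (cpartial j f) x"
proof -
  obtain r where r: "r > 0" "ball x (4 * r) \<subseteq> U"
    using open_ball_radius assms(1,3) .
  have "cpartial j (cpartial i f) x = integral {0..1} (\<lambda>t. cpartial j f (x + circ r t *s axis i 1) / circ r t)"
    by (subst has_cderiv_cpartial[OF cpartial_has_cderiv_circle_average[OF assms(2) r]])
       (simp add: axis_def if_distrib cong: if_cong)
  also have "\<dots> = cpartial i (cpartial j f) x"
    using r by (intro cpartial_circle_average[symmetric, OF holo_on_cpartial[OF assms(1,2)]])
      (auto simp: subset_iff)
  finally show ?thesis .
qed

section \<open>Poisson brackets and Hamiltonian vector fields\<close>

text \<open>The Hamiltonian vector field of \<open>f\<close>, with the sign for which \<open>{f, g}\<close> is the derivative of \<open>g\<close>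
along it.\<close>
definition ham :: "'i bivector \<Rightarrow> (complex ^ 'i::finite \<Rightarrow> complex) \<Rightarrow> complex ^ 'i \<Rightarrow> complex ^ 'i" where
  "ham \<pi> f x = (\<Sum>i\<in>UNIV. cpartial i f x *s \<pi> x $ i)"

lemma pbracket_ham:
  assumes "has_cderiv g D x"
  shows "pbracket \<pi> f g x = D (ham \<pi> f x)"
proof -
  have "pbracket \<pi> f g x = (\<Sum>j\<in>UNIV. \<Sum>i\<in>UNIV. \<pi> x $ i $ j * cpartial i f x * cpartial j g x)"
    unfolding pbracket_def by (rule sum.swap)
  also have "\<dots> = D (ham \<pi> f x)"
    by (simp add: has_cderiv_expand[OF assms] ham_def sum_distrib_left mult_ac)
  finally show ?thesis .
qed

lemma has_cderiv_sum_smult: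
  assumes "has_cderiv f D (x :: complex ^ 'i::finite)"
  shows "D (\<Sum>k\<in>K. c k *s v k) = (\<Sum>k\<in>K. c k * D (v k))"
proof -
  have "linear D" and "\<And>c v. D (c *s v) = c * D v"
    using assms has_derivative_linear by (auto simp: has_cderiv_def)
  then show ?thesis by (simp add: linear_sum)
qed

lemma pbracket_cderiv:
  fixes x :: "complex ^ 'i::finite"
  assumes "open U" "holo_on g U" "holo_on h U" "x \<in> U"
    and \<pi>: "\<And>j k. has_cderiv (\<lambda>x. \<pi> x $ j $ k) (d\<pi> j k) x"
  shows "has_cderiv (pbracket \<pi> g h)
    (\<lambda>v. \<Sum>j\<in>UNIV. \<Sum>k\<in>UNIV.
      \<pi> x $ j $ k * cpartial j g x * (\<Sum>i\<in>UNIV. cpartial i (cpartial k h) x * v $ i)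
      + (\<pi> x $ j $ k * (\<Sum>i\<in>UNIV. cpartial i (cpartial j g) x * v $ i)
         + d\<pi> j k v * cpartial j g x) * cpartial k h x) x"
  unfolding pbracket_def[abs_def]
  by (intro has_cderiv_sum has_cderiv_mult \<pi> holo_on_has_cderiv[OF holo_on_cpartial[OF assms(1)]] assms)

definition hessian :: "(complex ^ 'i::finite \<Rightarrow> complex) \<Rightarrow> complex ^ 'i \<Rightarrow> complex ^ 'i \<Rightarrow> complex ^ 'i \<Rightarrow> complex" where
  "hessian f x u w = (\<Sum>i\<in>UNIV. \<Sum>j\<in>UNIV. cpartial i (cpartial j f) x * u $ i * w $ j)"

lemma hessian_commute:
  assumes "open U" "holo_on f U" "x \<in> U"
  shows "hessian f x u w = hessian f x w u"
  unfolding hessian_def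
  by (subst sum.swap, subst cpartial_commute[OF assms]) (simp add: mult_ac)

text \<open>Differentiating \<open>{g, h}\<close> along the Hamiltonian field of \<open>f\<close> hits the bivector, \<open>h\<close> or \<open>g\<close>. The last
two contributions are Hessians evaluated on Hamiltonian fields; the minus sign comes from the
antisymmetry of the bivector. Under cyclic permutation every Hessian occurs twice, with opposite
signs and exchanged arguments.\<close>
lemma pbracket_pbracket:
  fixes x :: "complex ^ 'i::finite"
  assumes "open U" "holo_on g U" "holo_on h U" "x \<in> U"
    and \<pi>: "\<And>j k. has_cderiv (\<lambda>x. \<pi> x $ j $ k) (d\<pi> j k) x"
    and antisym: "\<And>j k. \<pi> x $ j $ k = - \<pi> x $ k $ j"
  shows "pbracket \<pi> f (pbracket \<pi> g h) x =
    (\<Sum>i\<in>UNIV. \<Sum>j\<in>UNIV. \<Sum>k\<in>UNIV. d\<pi> j k (\<pi> x $ i) * (cpartial i f x * cpartial j g x * cpartial k h x))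
    + hessian h x (ham \<pi> f x) (ham \<pi> g x) - hessian g x (ham \<pi> f x) (ham \<pi> h x)"
proof -
  define u where "u = ham \<pi> f x"
  define S where "S g j = (\<Sum>i\<in>UNIV. cpartial i (cpartial j g) x * u $ i)" for g j
  have "pbracket \<pi> f (pbracket \<pi> g h) x =
      (\<Sum>j\<in>UNIV. \<Sum>k\<in>UNIV. d\<pi> j k u * (cpartial j g x * cpartial k h x))
      + (\<Sum>j\<in>UNIV. \<Sum>k\<in>UNIV. \<pi> x $ j $ k * cpartial j g x * S h k)
      + (\<Sum>j\<in>UNIV. \<Sum>k\<in>UNIV. \<pi> x $ j $ k * cpartial k h x * S g j)"
    unfolding pbracket_ham[OF pbracket_cderiv[OF assms(1-4) \<pi>]] u_def[symmetric] S_def[symmetric]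
    by (simp add: sum.distrib[symmetric] algebra_simps del: sum.distrib)
  also have "(\<Sum>j\<in>UNIV. \<Sum>k\<in>UNIV. d\<pi> j k u * (cpartial j g x * cpartial k h x))
    = (\<Sum>j\<in>UNIV. \<Sum>k\<in>UNIV. \<Sum>i\<in>UNIV. d\<pi> j k (\<pi> x $ i) * (cpartial i f x * cpartial j g x * cpartial k h x))"
    unfolding u_def ham_def by (simp add: has_cderiv_sum_smult[OF \<pi>] sum_distrib_left mult_ac)
  also have "\<dots> = (\<Sum>j\<in>UNIV. \<Sum>i\<in>UNIV. \<Sum>k\<in>UNIV. d\<pi> j k (\<pi> x $ i) * (cpartial i f x * cpartial j g x * cpartial k h x))"
    by (intro sum.cong refl sum.swap)
  also have "\<dots> = (\<Sum>i\<in>UNIV. \<Sum>j\<in>UNIV. \<Sum>k\<in>UNIV. d\<pi> j k (\<pi> x $ i) * (cpartial i f x * cpartial j g x * cpartial k h x))"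
    by (rule sum.swap)
  also have "(\<Sum>j\<in>UNIV. \<Sum>k\<in>UNIV. \<pi> x $ j $ k * cpartial j g x * S h k)
      = (\<Sum>k\<in>UNIV. \<Sum>j\<in>UNIV. \<pi> x $ j $ k * cpartial j g x * S h k)"
    by (rule sum.swap)
  also have "\<dots> = (\<Sum>k\<in>UNIV. ham \<pi> g x $ k * S h k)"
    by (simp add: ham_def sum_distrib_left mult_ac)
  also have "\<dots> = (\<Sum>k\<in>UNIV. \<Sum>i\<in>UNIV. cpartial i (cpartial k h) x * u $ i * ham \<pi> g x $ k)"
    by (simp add: S_def sum_distrib_left mult_ac)
  also have "\<dots> = hessian h x u (ham \<pi> g x)"
    unfolding hessian_def by (rule sum.swap)
  also have "(\<Sum>j\<in>UNIV. \<Sum>k\<in>UNIV. \<pi> x $ j $ k * cpartial k h x * S g j)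
      = (\<Sum>j\<in>UNIV. - ham \<pi> h x $ j * S g j)"
    by (subst antisym) (simp add: ham_def sum_distrib_left sum_negf mult_ac)
  also have "\<dots> = - (\<Sum>j\<in>UNIV. \<Sum>i\<in>UNIV. cpartial i (cpartial j g) x * u $ i * ham \<pi> h x $ j)"
    by (simp add: S_def sum_distrib_left sum_negf mult_ac)
  also have "\<dots> = - hessian g x u (ham \<pi> h x)"
    unfolding hessian_def by (subst sum.swap) (rule refl)
  finally show ?thesis unfolding u_def by simp
qed

lemma sum_rotate:
  "(\<Sum>i\<in>A. \<Sum>j\<in>B. \<Sum>k\<in>C. F i j k) = (\<Sum>j\<in>B. \<Sum>k\<in>C. \<Sum>i\<in>A. (F i j k :: 'a::comm_monoid_add))"
  by (subst sum.swap) (intro sum.cong refl sum.swap)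

text \<open>The cyclic sum in the assumption is the Jacobiator of three coordinate functions: \<open>\<pi> x $ i\<close>
is the Hamiltonian field of the \<open>i\<close>-th coordinate, along which the component
\<open>{x\<^sub>j, x\<^sub>k}\<close> is differentiated.\<close>
lemma poisson_structureI:
  fixes \<pi> :: "'i::finite bivector"
  assumes "open M"
    and \<pi>: "\<And>x j k. x \<in> M \<Longrightarrow> has_cderiv (\<lambda>x. \<pi> x $ j $ k) (d\<pi> x j k) x"
    and antisym: "\<And>x j k. x \<in> M \<Longrightarrow> \<pi> x $ j $ k = - \<pi> x $ k $ j"
    and jacobi: "\<And>x i j k. x \<in> M \<Longrightarrow>
      d\<pi> x j k (\<pi> x $ i) + d\<pi> x k i (\<pi> x $ j) + d\<pi> x i j (\<pi> x $ k) = 0"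
  shows "poisson_structure M \<pi>"
  unfolding poisson_structure_def
proof (intro conjI allI impI ballI assms)
  show "holo_on (\<lambda>x. \<pi> x $ i $ j) M" for i j
    using \<pi> by (rule holo_onI)
next
  fix U f g h x
  assume U: "open U \<and> U \<subseteq> M \<and> holo_on f U \<and> holo_on g U \<and> holo_on h U" and "x \<in> U"
  then have x: "x \<in> M" by blast
  let ?T = "\<lambda>f g h. \<Sum>i\<in>UNIV. \<Sum>j\<in>UNIV. \<Sum>k\<in>UNIV.
    d\<pi> x j k (\<pi> x $ i) * (cpartial i f x * cpartial j g x * cpartial k h x)"
  let ?H = "\<lambda>f g h. hessian f x (ham \<pi> g x) (ham \<pi> h x)"
  have expand: "pbracket \<pi> f (pbracket \<pi> g h) x = ?T f g h + ?H h f g - ?H g f h"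
    if "holo_on g U" "holo_on h U" for f g h
    using U \<open>x \<in> U\<close> that by (intro pbracket_pbracket \<pi> antisym x) auto
  have sym: "?H f g h = ?H f h g" if "holo_on f U" for f g h
    using U \<open>x \<in> U\<close> that by (intro hessian_commute) auto
  have "?T g h f = (\<Sum>i\<in>UNIV. \<Sum>j\<in>UNIV. \<Sum>k\<in>UNIV.
      d\<pi> x k i (\<pi> x $ j) * (cpartial j g x * cpartial k h x * cpartial i f x))"
    by (rule sum_rotate[symmetric])
  moreover have "?T h f g = (\<Sum>i\<in>UNIV. \<Sum>j\<in>UNIV. \<Sum>k\<in>UNIV.
      d\<pi> x i j (\<pi> x $ k) * (cpartial k h x * cpartial i f x * cpartial j g x))"
    by (rule sum_rotate)
  ultimately have "?T f g h + ?T g h f + ?T h f g = (\<Sum>i\<in>UNIV. \<Sum>j\<in>UNIV. \<Sum>k\<in>UNIV.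
     (d\<pi> x j k (\<pi> x $ i) + d\<pi> x k i (\<pi> x $ j) + d\<pi> x i j (\<pi> x $ k))
      * (cpartial i f x * cpartial j g x * cpartial k h x))"
    by (simp add: sum.distrib distrib_left mult_ac)
  also have "\<dots> = 0"
    by (simp add: jacobi[OF x])
  finally show "pbracket \<pi> f (pbracket \<pi> g h) x + pbracket \<pi> g (pbracket \<pi> h f) x
      + pbracket \<pi> h (pbracket \<pi> f g) x = 0"
    using U sym[of f g h] sym[of g h f] sym[of h f g] by (simp add: expand add.assoc)
qed

lemma pbracket_comp:
  fixes \<phi> :: "complex ^ 'i::finite \<Rightarrow> complex ^ 'j::finite"
  assumes \<phi>: "\<And>j. holo_on (\<lambda>x. \<phi> x $ j) M" and x: "x \<in> M"
    and f: "has_cderiv f D (\<phi> x)" and g: "has_cderiv g E (\<phi> x)"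
  shows "pbracket \<pi> (f \<circ> \<phi>) (g \<circ> \<phi>) x = (\<Sum>j\<in>UNIV. \<Sum>k\<in>UNIV.
    pbracket \<pi> (\<lambda>x. \<phi> x $ j) (\<lambda>x. \<phi> x $ k) x * cpartial j f (\<phi> x) * cpartial k g (\<phi> x))"
proof -
  define \<Phi> where "\<Phi> v = (\<chi> j. \<Sum>i\<in>UNIV. cpartial i (\<lambda>x. \<phi> x $ j) x * v $ i)" for v
  have \<Phi>: "has_cderiv (\<lambda>x. \<phi> x $ j) (\<lambda>v. \<Phi> v $ j) x" for j
    using holo_on_has_cderiv[OF \<phi> x] by (simp add: \<Phi>_def)
  have chain_f: "cpartial i (f \<circ> \<phi>) x = (\<Sum>j\<in>UNIV. cpartial j f (\<phi> x) * cpartial i (\<lambda>x. \<phi> x $ j) x)" for i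
    by (simp add: has_cderiv_cpartial[OF has_cderiv_chain[OF f \<Phi>]] has_cderiv_expand[OF f]
        has_cderiv_cpartial[OF \<Phi>])
  have "ham \<pi> (f \<circ> \<phi>) x = (\<Sum>j\<in>UNIV. cpartial j f (\<phi> x) *s ham \<pi> (\<lambda>x. \<phi> x $ j) x)"
    unfolding ham_def chain_f
    by (simp only: vec.scale_sum_left vec.scale_sum_right vec.scale_scale) (rule sum.swap)
  then have "pbracket \<pi> (f \<circ> \<phi>) (g \<circ> \<phi>) x = E (\<Phi> (\<Sum>j\<in>UNIV. cpartial j f (\<phi> x) *s ham \<pi> (\<lambda>x. \<phi> x $ j) x))"
    by (simp add: pbracket_ham[OF has_cderiv_chain[OF g \<Phi>]])
  also have "\<dots> = (\<Sum>k\<in>UNIV. cpartial k g (\<phi> x) * (\<Sum>j\<in>UNIV. cpartial j f (\<phi> x) * \<Phi> (ham \<pi> (\<lambda>x. \<phi> x $ j) x) $ k))"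
    by (simp add: has_cderiv_expand[OF g] has_cderiv_sum_smult[OF \<Phi>])
  also have "\<dots> = (\<Sum>k\<in>UNIV. \<Sum>j\<in>UNIV.
    pbracket \<pi> (\<lambda>x. \<phi> x $ j) (\<lambda>x. \<phi> x $ k) x * cpartial j f (\<phi> x) * cpartial k g (\<phi> x))"
    by (simp add: pbracket_ham[OF \<Phi>] sum_distrib_left mult_ac)
  finally show ?thesis by (subst sum.swap)
qed

lemma poisson_morphismI:
  fixes \<phi> :: "complex ^ 'i::finite \<Rightarrow> complex ^ 'j::finite"
  assumes "poisson_structure M \<pi>" "poisson_structure N \<rho>" "\<phi> ` M \<subseteq> N"
    and \<phi>: "\<And>j. holo_on (\<lambda>x. \<phi> x $ j) M"
    and coord: "\<And>x j k. x \<in> M \<Longrightarrow> pbracket \<pi> (\<lambda>x. \<phi> x $ j) (\<lambda>x. \<phi> x $ k) x = \<rho> (\<phi> x) $ j $ k"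
  shows "poisson_morphism M \<pi> N \<rho> \<phi>"
  unfolding poisson_morphism_def
proof (intro conjI allI impI ballI assms)
  fix V f g x
  assume V: "open V \<and> V \<subseteq> N \<and> holo_on f V \<and> holo_on g V" and x: "x \<in> M \<inter> \<phi> -` V"
  then have "has_cderiv f (\<lambda>v. \<Sum>i\<in>UNIV. cpartial i f (\<phi> x) * v $ i) (\<phi> x)"
    "has_cderiv g (\<lambda>v. \<Sum>i\<in>UNIV. cpartial i g (\<phi> x) * v $ i) (\<phi> x)"
    by (auto intro: holo_on_has_cderiv)
  with x show "pbracket \<pi> (f \<circ> \<phi>) (g \<circ> \<phi>) x = pbracket \<rho> f g (\<phi> x)"
    by (subst pbracket_comp[OF \<phi>]) (auto simp: coord pbracket_def[of \<rho>])
qed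

section \<open>The Kirillov--Kostant bivector\<close>
lemma sum_UNIV_prod:
  "(\<Sum>p\<in>(UNIV :: ('a::finite \<times> 'b::finite) set). f p) = (\<Sum>a\<in>UNIV. \<Sum>b\<in>UNIV. f (a, b))"
  by (simp add: sum.cartesian_product)

lemma sum_if_const: "(\<Sum>k\<in>K. if P then f k else 0) = (if P then \<Sum>k\<in>K. f k else 0)"
  by simp

lemmas delta_simps = mult_delta_left mult_delta_right sum_if_const

lemma pbracket_coord: "pbracket \<pi> (\<lambda>x. x $ i) (\<lambda>x. x $ j) x = \<pi> x $ i $ (j :: 'i::finite)"
  unfolding pbracket_def
  by (simp add: has_cderiv_cpartial[OF has_cderiv_coord] axis_def delta_simps)

lemma Emat_nth: "Emat i j $ a $ b = (if a = i then if b = j then 1 else 0 else 0)"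
  by (simp add: Emat_def)

lemma tensor_bracket_nth:
  "tensor_bracket \<pi> X Y x $ (a, c) $ (b, d) = pbracket \<pi> (\<lambda>y. X y $ a $ b) (\<lambda>y. Y y $ c $ d) x"
  unfolding tensor_bracket_def
  by (simp add: msmult_def kron_def Emat_nth delta_simps)

lemma Pmat_nth: "Pmat $ (a, c) $ (b, d) = (if a = d then if c = b then 1 else 0 else 0)"
  unfolding Pmat_def
  by (simp add: kron_def Emat_nth delta_simps)

lemma commutator_Pmat_nth:
  "commutator (kron A (mat 1)) Pmat $ (a, c) $ (b, d) =
     (if b = c then A $ a $ d else 0) - (if a = d then A $ c $ b else 0)"
  unfolding commutator_def matrix_matrix_mult_def
  by (simp add: sum_UNIV_prod kron_def Pmat_nth mat_def delta_simps)

text \<open>These components are the values of the trace formula on \<open>F = E\<^sub>b\<^sub>a\<close> and \<open>H = E\<^sub>d\<^sub>c\<close>, for which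
\<open>tr (A F)\<close> and \<open>tr (A H)\<close> are the coordinates \<open>A\<^sub>a\<^sub>b\<close> and \<open>A\<^sub>c\<^sub>d\<close>. They are read with
\<open>p = (a, b)\<close> and \<open>q = (c, d)\<close>.\<close>
definition kk_bivector :: "('n::finite \<times> 'n) bivector" where
  "kk_bivector x = (\<chi> p q. (if snd p = fst q then x $ (fst p, snd q) else 0)
     - (if fst p = snd q then x $ (fst q, snd p) else 0))"

lemma kk_bivector_nth:
  "kk_bivector x $ (a, b) $ (c, d) =
     (if b = c then x $ (a, d) else 0) - (if a = d then x $ (c, b) else 0)"
  by (simp add: kk_bivector_def)

text \<open>The tensor notation packs all brackets of entries into one matrix, and the entries of
\<open>[A \<otimes> 1, P]\<close> are the components of \<open>kk_bivector\<close>; this serves both the characterisation of the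
Kirillov--Kostant structure and the bracket of the entries of \<open>G L G\<^sup>-\<^sup>1\<close>.\<close>
lemma tensor_bracket_iff:
  "tensor_bracket \<pi> X X x = commutator (kron (mat_of y) (mat 1)) Pmat \<longleftrightarrow>
     (\<forall>a b c d. pbracket \<pi> (\<lambda>x. X x $ a $ b) (\<lambda>x. X x $ c $ d) x = kk_bivector y $ (a, b) $ (c, d))"
  by (auto simp: vec_eq_iff tensor_bracket_nth commutator_Pmat_nth kk_bivector_nth mat_of_def)

lemma trace_mult: "trace (A ** B) = (\<Sum>i\<in>UNIV. \<Sum>k\<in>UNIV. A $ i $ k * B $ k $ i)"
  by (simp add: trace_def matrix_matrix_mult_def)

lemma trace_has_cderiv:
  "has_cderiv (\<lambda>y. trace (mat_of y ** F)) (\<lambda>v. trace (mat_of v ** F)) x"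
proof -
  have "has_cderiv (\<lambda>y. \<Sum>i\<in>UNIV. \<Sum>k\<in>UNIV. F $ k $ i * y $ (i, k))
    (\<lambda>v. \<Sum>i\<in>UNIV. \<Sum>k\<in>UNIV. F $ k $ i * v $ (i, k) + 0 * x $ (i, k)) x"
    by (intro has_cderiv_sum has_cderiv_mult has_cderiv_coord has_cderiv_const)
  then show ?thesis
    by (simp add: trace_mult mat_of_def mult.commute)
qed

lemma pbracket_trace:
  "pbracket \<pi> (\<lambda>y. trace (mat_of y ** F)) (\<lambda>y. trace (mat_of y ** H)) x =
    (\<Sum>a\<in>UNIV. \<Sum>b\<in>UNIV. \<Sum>c\<in>UNIV. \<Sum>d\<in>UNIV. \<pi> x $ (a, b) $ (c, d) * F $ b $ a * H $ d $ c)"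
proof -
  have "cpartial (a, b) (\<lambda>y. trace (mat_of y ** F)) x = F $ b $ a" for a b F
  proof -
    have "mat_of (axis (a, b) 1) $ i $ k = (if i = a then if k = b then 1 else 0 else 0)" for i k
      by (simp add: mat_of_def axis_def)
    then show ?thesis
      by (subst has_cderiv_cpartial[OF trace_has_cderiv]) (simp add: trace_mult delta_simps)
  qed
  then show ?thesis
    by (simp add: pbracket_def sum_UNIV_prod)
qed

text \<open>The trace formula is bilinear in \<open>F\<close> and \<open>H\<close>, so it holds in general once the two quadruple sums
agree; conversely the elementary matrices recover every component of the bivector.\<close>
lemma kirillov_kostant_iff:
  fixes \<kappa> :: "('n::finite \<times> 'n) bivector"
  shows "kirillov_kostant \<kappa> \<longleftrightarrow> \<kappa> = kk_bivector"
proof -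
  have kk: "pbracket kk_bivector (\<lambda>y. trace (mat_of y ** F)) (\<lambda>y. trace (mat_of y ** H)) x =
      trace (mat_of x ** commutator H F)" for F H :: "complex ^ 'n ^ 'n" and x
  proof -
    have "pbracket kk_bivector (\<lambda>y. trace (mat_of y ** F)) (\<lambda>y. trace (mat_of y ** H)) x =
      (\<Sum>a\<in>UNIV. \<Sum>b\<in>UNIV. \<Sum>d\<in>UNIV. x $ (a, d) * F $ b $ a * H $ d $ b)
      - (\<Sum>a\<in>UNIV. \<Sum>b\<in>UNIV. \<Sum>c\<in>UNIV. x $ (c, b) * F $ b $ a * H $ a $ c)"
      unfolding pbracket_trace kk_bivector_nth left_diff_distrib
      by (simp add: sum_subtractf delta_simps)
    also have "(\<Sum>a\<in>UNIV. \<Sum>b\<in>UNIV. \<Sum>d\<in>UNIV. x $ (a, d) * F $ b $ a * H $ d $ b)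
      = (\<Sum>a\<in>UNIV. \<Sum>d\<in>UNIV. \<Sum>b\<in>UNIV. x $ (a, d) * F $ b $ a * H $ d $ b)"
      by (intro sum.cong refl sum.swap)
    also have "(\<Sum>a\<in>UNIV. \<Sum>b\<in>UNIV. \<Sum>c\<in>UNIV. x $ (c, b) * F $ b $ a * H $ a $ c)
      = (\<Sum>c\<in>UNIV. \<Sum>b\<in>UNIV. \<Sum>a\<in>UNIV. x $ (c, b) * F $ b $ a * H $ a $ c)"
      by (subst sum_rotate, subst sum_rotate, subst sum.swap, rule refl)
    also have "(\<Sum>a\<in>UNIV. \<Sum>d\<in>UNIV. \<Sum>b\<in>UNIV. x $ (a, d) * F $ b $ a * H $ d $ b)
      - (\<Sum>c\<in>UNIV. \<Sum>b\<in>UNIV. \<Sum>a\<in>UNIV. x $ (c, b) * F $ b $ a * H $ a $ c)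
      = trace (mat_of x ** commutator H F)"
      unfolding trace_mult
      by (simp add: commutator_def matrix_matrix_mult_def mat_of_def right_diff_distrib
          sum_subtractf sum_distrib_left mult_ac)
    finally show ?thesis .
  qed
  show ?thesis
  proof
    assume \<kappa>: "kirillov_kostant \<kappa>"
    have "\<kappa> x $ (a, b) $ (c, d) = kk_bivector x $ (a, b) $ (c, d)" for x a b c d
    proof -
      have E: "(\<lambda>y. trace (mat_of y ** Emat b a)) = (\<lambda>y. y $ (a, b))" for a b :: 'n
      proof
        fix y :: "complex ^ ('n \<times> 'n)"
        show "trace (mat_of y ** Emat b a) = y $ (a, b)"
          by (simp add: trace_mult mat_of_def Emat_nth delta_simps)
      qed
      have "pbracket \<kappa> (\<lambda>y. trace (mat_of y ** Emat b a)) (\<lambda>y. trace (mat_of y ** Emat d c)) x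
        = pbracket kk_bivector (\<lambda>y. trace (mat_of y ** Emat b a)) (\<lambda>y. trace (mat_of y ** Emat d c)) x"
        using \<kappa> by (simp add: kirillov_kostant_def kk)
      then show ?thesis unfolding E pbracket_coord .
    qed
    then show "\<kappa> = kk_bivector"
      by (simp add: fun_eq_iff vec_eq_iff)
  next
    assume "\<kappa> = kk_bivector"
    then show "kirillov_kostant \<kappa>"
      by (simp add: kirillov_kostant_def kk)
  qed
qed

text \<open>The components are linear, so each is its own derivative.\<close>
lemma poisson_structure_kk: "poisson_structure UNIV (kk_bivector :: ('n::finite \<times> 'n) bivector)"
proof (rule poisson_structureI[where d\<pi> = "\<lambda>x j k v. kk_bivector v $ j $ k"])
  fix x :: "complex ^ ('n \<times> 'n)" and p q r :: "'n \<times> 'n"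
  show "has_cderiv (\<lambda>x. kk_bivector x $ p $ q) (\<lambda>v. kk_bivector v $ p $ q) x"
    unfolding kk_bivector_def vec_lambda_beta
    by (intro has_cderiv_diff has_cderiv_if has_cderiv_coord has_cderiv_const)
  show "kk_bivector x $ p $ q = - kk_bivector x $ q $ p"
    by (simp add: kk_bivector_def)
  show "kk_bivector (kk_bivector x $ p) $ q $ r + kk_bivector (kk_bivector x $ q) $ r $ p
      + kk_bivector (kk_bivector x $ r) $ p $ q = 0"
    by (cases p, cases q, cases r) (simp add: kk_bivector_nth)
qed simp

section \<open>The Poisson structure on pairs of an invertible matrix and a spectrum\<close>
lemma matrix_inv_inverse:
  fixes A :: "complex ^ 'n::finite ^ 'n"
  assumes "invertible A"
  shows "A ** matrix_inv A = mat 1" "matrix_inv A ** A = mat 1"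
  using someI_ex[OF assms[unfolded invertible_def]] by (auto simp: matrix_inv_def)

text \<open>Cramer's rule for the columns of the inverse; it makes the inverse a holomorphic function of the
matrix.\<close>
lemma matrix_inv_nth:
  fixes A :: "complex ^ 'n::finite ^ 'n"
  assumes "invertible A"
  shows "matrix_inv A $ i $ j = det (\<chi> a b. if b = i then axis j 1 $ a else A $ a $ b) / det A"
proof -
  have "A *v column j (matrix_inv A) = axis j 1"
    using matrix_inv_inverse(1)[OF assms]
    by (simp add: vec_eq_iff matrix_vector_mult_def matrix_matrix_mult_def column_def mat_def axis_def)
  then have "column j (matrix_inv A)
      = (\<chi> k. det (\<chi> a b. if b = k then axis j 1 $ a else A $ a $ b) / det A)"
    using assms by (simp add: cramer invertible_det_nz)
  then show ?thesis by (simp add: vec_eq_iff column_def)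
qed

lemma holo_on_det:
  assumes "\<And>a b. holo_on (\<lambda>x. A x $ a $ b) U"
  shows "holo_on (\<lambda>x. det (A x :: complex ^ 'n::finite ^ 'n)) (U :: (complex ^ 'i::finite) set)"
  unfolding det_def
  by (intro holo_on_sum holo_on_mult holo_on_prod holo_on_const assms) simp_all

lemma holo_on_Gmat: "holo_on (\<lambda>x. Gmat x $ a $ b) U"
  by (simp add: Gmat_def holo_on_coord)

lemma open_GL_hss: "open (GL_hss :: (complex ^ (('n::finite \<times> 'n) + 'n)) set)"
proof -
  have eq: "GL_hss = {x :: complex ^ (('n \<times> 'n) + 'n). det (Gmat x) \<noteq> 0} \<inter>
      (\<Inter>p \<in> {p. fst p \<noteq> snd p}. {x. x $ Inr (fst p) \<noteq> x $ Inr (snd p)})"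
    by (auto simp: GL_hss_def invertible_det_nz inj_def; blast)
  have det: "open {x :: complex ^ (('n \<times> 'n) + 'n). det (Gmat x) \<noteq> 0}"
    using holo_on_continuous[OF holo_on_det[OF holo_on_Gmat]]
    by (intro open_Collect_neq) auto
  show ?thesis
    unfolding eq
    by (intro open_Int[OF det] open_INT[OF finite] ballI open_Collect_neq continuous_intros)
qed

lemma GL_hss_bivector_nth:
  "GL_hss_bivector x $ Inl (b, j) $ Inl (c, l) =
     (if j = l then 0 else x $ Inl (b, l) * x $ Inl (c, j) / (x $ Inr j - x $ Inr l))"
  "GL_hss_bivector x $ Inl (b, j) $ Inr l = (if l = j then - x $ Inl (b, j) else 0)"
  "GL_hss_bivector x $ Inr l $ Inl (b, j) = (if l = j then x $ Inl (b, j) else 0)"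
  "GL_hss_bivector x $ Inr k $ Inr l = 0"
  by (simp_all add: GL_hss_bivector_def)

definition GL_hss_bivector_deriv ::
  "complex ^ (('n::finite \<times> 'n) + 'n) \<Rightarrow> ('n \<times> 'n) + 'n \<Rightarrow> ('n \<times> 'n) + 'n
     \<Rightarrow> complex ^ (('n \<times> 'n) + 'n) \<Rightarrow> complex" where
  "GL_hss_bivector_deriv x p q v = (case (p, q) of
       (Inl (b, j), Inl (c, l)) \<Rightarrow>
          if j = l then 0
          else ((x $ Inl (b, l) * v $ Inl (c, j) + v $ Inl (b, l) * x $ Inl (c, j)) * (x $ Inr j - x $ Inr l)
                - x $ Inl (b, l) * x $ Inl (c, j) * (v $ Inr j - v $ Inr l))
               / ((x $ Inr j - x $ Inr l) * (x $ Inr j - x $ Inr l))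
     | (Inl (b, k), Inr l) \<Rightarrow> if l = k then - v $ Inl (b, k) else 0
     | (Inr l, Inl (b, k)) \<Rightarrow> if l = k then v $ Inl (b, k) else 0
     | (Inr k, Inr l) \<Rightarrow> 0)"

lemma GL_hss_distinct: "x \<in> GL_hss \<Longrightarrow> j \<noteq> k \<Longrightarrow> x $ Inr j \<noteq> x $ Inr k"
  by (auto simp: GL_hss_def inj_def)

lemma GL_hss_bivector_has_cderiv:
  fixes x :: "complex ^ (('n::finite \<times> 'n) + 'n)"
  assumes "x \<in> GL_hss"
  shows "has_cderiv (\<lambda>x. GL_hss_bivector x $ p $ q) (GL_hss_bivector_deriv x p q) x"
proof -
  have quot: "has_cderiv (\<lambda>x. x $ Inl (b, l) * x $ Inl (c, j) / (x $ Inr j - x $ Inr l))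
      (\<lambda>v. ((x $ Inl (b, l) * v $ Inl (c, j) + v $ Inl (b, l) * x $ Inl (c, j)) * (x $ Inr j - x $ Inr l)
                - x $ Inl (b, l) * x $ Inl (c, j) * (v $ Inr j - v $ Inr l))
               / ((x $ Inr j - x $ Inr l) * (x $ Inr j - x $ Inr l))) x" if "j \<noteq> l" for b c j l
    using GL_hss_distinct[OF assms that]
    by (intro has_cderiv_divide has_cderiv_mult has_cderiv_diff has_cderiv_coord) simp
  show ?thesis
    by (cases p; cases q)
       (auto simp: GL_hss_bivector_nth GL_hss_bivector_deriv_def[abs_def]
          intro!: quot has_cderiv_if has_cderiv_const has_cderiv_minus has_cderiv_coord)
qed

lemma cyclic_partial_fractions:
  fixes u v w :: complex
  assumes "u + v + w = 0" "u \<noteq> 0" "v \<noteq> 0" "w \<noteq> 0"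
  shows "1 / (u * v) + 1 / (v * w) + 1 / (w * u) = 0"
proof -
  have "1 / (u * v) + 1 / (v * w) + 1 / (w * u) = (u + v + w) / (u * v * w)"
    using assms(2-4) by (simp add: divide_simps)
  with assms(1) show ?thesis by simp
qed

text \<open>One of the three terms in the Jacobiator of \<open>G\<^sub>b\<^sub>j\<close>, \<open>G\<^sub>c\<^sub>l\<close>, \<open>G\<^sub>d\<^sub>m\<close> with distinct columns. The
denominator is not differentiated because \<open>G\<^sub>b\<^sub>j\<close> commutes with \<open>\<lambda>\<^sub>l\<close> and \<open>\<lambda>\<^sub>m\<close>. The two cubic
monomials on the right are invariant under cyclic permutations of the three pairs of indices, so
the cyclic sum only concerns the fractions.\<close>
lemma GL_hss_bivector_deriv_row:
  fixes x :: "complex ^ (('n::finite \<times> 'n) + 'n)"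
  assumes x: "x \<in> GL_hss" and ne: "j \<noteq> l" "l \<noteq> m" "j \<noteq> m"
  shows "GL_hss_bivector_deriv x (Inl (c, l)) (Inl (d, m)) (GL_hss_bivector x $ Inl (b, j)) =
    x $ Inl (b, l) * x $ Inl (c, m) * x $ Inl (d, j) * (1 / ((x $ Inr j - x $ Inr l) * (x $ Inr l - x $ Inr m)))
    - x $ Inl (b, m) * x $ Inl (c, j) * x $ Inl (d, l) * (1 / ((x $ Inr l - x $ Inr m) * (x $ Inr m - x $ Inr j)))"
proof -
  define P Q where "P = x $ Inl (b, l) * x $ Inl (c, m) * x $ Inl (d, j)"
    and "Q = x $ Inl (b, m) * x $ Inl (c, j) * x $ Inl (d, l)"
  define s t u where "s = x $ Inr l - x $ Inr m" and "t = x $ Inr j - x $ Inr l" and "u = x $ Inr m - x $ Inr j"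
  have nz: "s \<noteq> 0" "t \<noteq> 0" "u \<noteq> 0"
    using ne GL_hss_distinct[OF x] by (auto simp: s_def t_def u_def)
  have "x $ Inr j - x $ Inr m = - u"
    by (simp add: u_def)
  then have "GL_hss_bivector_deriv x (Inl (c, l)) (Inl (d, m)) (GL_hss_bivector x $ Inl (b, j)) =
      (P / t + Q / (- u)) * s / (s * s)"
    using ne by (simp add: GL_hss_bivector_nth GL_hss_bivector_deriv_def s_def t_def P_def Q_def mult_ac)
  also have "\<dots> = P * (1 / (t * s)) - Q * (1 / (s * u))"
    using nz by (simp add: field_simps)
  finally show ?thesis by (simp add: P_def Q_def s_def t_def u_def)
qed

lemma poisson_structure_GL_hss:
  "poisson_structure GL_hss (GL_hss_bivector :: (('n::finite \<times> 'n) + 'n) bivector)"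
proof (rule poisson_structureI[OF open_GL_hss GL_hss_bivector_has_cderiv])
  fix x :: "complex ^ (('n \<times> 'n) + 'n)" and p q r
  assume x: "x \<in> GL_hss"
  show "GL_hss_bivector x $ p $ q = - GL_hss_bivector x $ q $ p"
    by (cases p; cases q) (auto simp: GL_hss_bivector_nth minus_divide_right mult.commute)
  show "GL_hss_bivector_deriv x q r (GL_hss_bivector x $ p)
      + GL_hss_bivector_deriv x r p (GL_hss_bivector x $ q)
      + GL_hss_bivector_deriv x p q (GL_hss_bivector x $ r) = 0"
  proof (cases p; cases q; cases r)
    fix P Q R assume "p = Inl P" "q = Inl Q" "r = Inl R"
    moreover obtain b j c l d m where "P = (b, j)" "Q = (c, l)" "R = (d, m)"
      by (cases P, cases Q, cases R) auto
    ultimately have pqr: "p = Inl (b, j)" "q = Inl (c, l)" "r = Inl (d, m)"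
      by auto
    \<comment> \<open>If exactly two columns agree, one of the three brackets vanishes, and the other two cancel
      because the denominator is differentiated as well.\<close>
    consider "j = l" "l = m" | "j = l" "l \<noteq> m" | "j = m" "l \<noteq> m" | "l = m" "j \<noteq> m"
      | "j \<noteq> l" "l \<noteq> m" "j \<noteq> m" by metis
    then show ?thesis
    proof cases
      case 1
      then show ?thesis by (simp add: pqr GL_hss_bivector_nth GL_hss_bivector_deriv_def)
    next
      case 2
      with GL_hss_distinct[OF x] have "x $ Inr l - x $ Inr m \<noteq> 0" "x $ Inr m - x $ Inr l \<noteq> 0" by auto
      with 2 show ?thesis
        by (simp add: pqr GL_hss_bivector_nth GL_hss_bivector_deriv_def,
          simp add: divide_simps, simp add: algebra_simps)
    next
      case 3
      with GL_hss_distinct[OF x] have "x $ Inr l - x $ Inr m \<noteq> 0" "x $ Inr m - x $ Inr l \<noteq> 0" by auto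
      with 3 show ?thesis
        by (simp add: pqr GL_hss_bivector_nth GL_hss_bivector_deriv_def,
          simp add: divide_simps, simp add: algebra_simps)
    next
      case 4
      with GL_hss_distinct[OF x] have "x $ Inr j - x $ Inr m \<noteq> 0" "x $ Inr m - x $ Inr j \<noteq> 0" by auto
      with 4 show ?thesis
        by (simp add: pqr GL_hss_bivector_nth GL_hss_bivector_deriv_def,
          simp add: divide_simps, simp add: algebra_simps)
    next
      case 5
      define s t u where "s = 1 / ((x $ Inr j - x $ Inr l) * (x $ Inr l - x $ Inr m))"
        and "t = 1 / ((x $ Inr l - x $ Inr m) * (x $ Inr m - x $ Inr j))"
        and "u = 1 / ((x $ Inr m - x $ Inr j) * (x $ Inr j - x $ Inr l))"
      have "s + t + u = 0"
        unfolding s_def t_def u_def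
        using 5 by (intro cyclic_partial_fractions) (auto dest: GL_hss_distinct[OF x])
      moreover have "GL_hss_bivector_deriv x q r (GL_hss_bivector x $ p)
          + GL_hss_bivector_deriv x r p (GL_hss_bivector x $ q)
          + GL_hss_bivector_deriv x p q (GL_hss_bivector x $ r)
        = x $ Inl (b, l) * x $ Inl (c, m) * x $ Inl (d, j) * (s + t + u)
          - x $ Inl (b, m) * x $ Inl (c, j) * x $ Inl (d, l) * (s + t + u)"
        unfolding pqr GL_hss_bivector_deriv_row[OF x 5]
          GL_hss_bivector_deriv_row[OF x 5(2) 5(3)[symmetric] 5(1)[symmetric]]
          GL_hss_bivector_deriv_row[OF x 5(3)[symmetric] 5(1) 5(2)[symmetric]]
          s_def[symmetric] t_def[symmetric] u_def[symmetric]
        by (simp add: algebra_simps)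
      ultimately show ?thesis by simp
    qed
  qed (auto simp: GL_hss_bivector_nth GL_hss_bivector_deriv_def divide_simps GL_hss_distinct[OF x],
      (simp add: algebra_simps)+)
qed

section \<open>The map to conjugates of diagonal matrices\<close>
lemma Gmat_inverse_sum:
  fixes x :: "complex ^ (('n::finite \<times> 'n) + 'n)"
  assumes "x \<in> GL_hss"
  shows "(\<Sum>k\<in>UNIV. x $ Inl (i, k) * matrix_inv (Gmat x) $ k $ j) = (if i = j then 1 else 0)"
    "(\<Sum>k\<in>UNIV. matrix_inv (Gmat x) $ i $ k * x $ Inl (k, j)) = (if i = j then 1 else 0)"
proof -
  have "invertible (Gmat x)" using assms by (simp add: GL_hss_def)
  from matrix_inv_inverse[OF this]
  show "(\<Sum>k\<in>UNIV. x $ Inl (i, k) * matrix_inv (Gmat x) $ k $ j) = (if i = j then 1 else 0)"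
    "(\<Sum>k\<in>UNIV. matrix_inv (Gmat x) $ i $ k * x $ Inl (k, j)) = (if i = j then 1 else 0)"
    by (simp_all add: vec_eq_iff matrix_matrix_mult_def mat_def Gmat_def)
qed

lemma adj_map_nth:
  "adj_map x $ (a, b) = (\<Sum>k\<in>UNIV. x $ Inl (a, k) * x $ Inr k * matrix_inv (Gmat x) $ k $ b)"
  by (simp add: adj_map_def vec_of_def matrix_matrix_mult_def Gmat_def Lmat_def delta_simps)

lemma holo_on_adj_map:
  "holo_on (\<lambda>x. adj_map x $ p) (GL_hss :: (complex ^ (('n::finite \<times> 'n) + 'n)) set)"
proof -
  have inv: "holo_on (\<lambda>x. matrix_inv (Gmat x) $ k $ b) (GL_hss :: (complex ^ (('n \<times> 'n) + 'n)) set)" for k b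
  proof -
    have H: "holo_on (\<lambda>x. det (\<chi> a c. if c = k then axis b 1 $ a else Gmat x $ a $ c) / det (Gmat x))
       (GL_hss :: (complex ^ (('n \<times> 'n) + 'n)) set)"
    proof (intro holo_on_divide holo_on_det)
      show "holo_on (\<lambda>x. (\<chi> a c. if c = k then axis b 1 $ a else Gmat x $ a $ c) $ a $ c) GL_hss" for a c
        by (cases "c = k") (simp_all add: holo_on_const holo_on_Gmat)
    qed (auto simp: holo_on_Gmat GL_hss_def invertible_det_nz)
    have cramer: "matrix_inv (Gmat x) $ k $ b
        = det (\<chi> a c. if c = k then axis b 1 $ a else Gmat x $ a $ c) / det (Gmat x)"
      if "x \<in> GL_hss" for x :: "complex ^ (('n \<times> 'n) + 'n)"
      using that by (intro matrix_inv_nth) (simp add: GL_hss_def)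
    show ?thesis
      by (rule holo_on_transform[OF open_GL_hss H]) (simp add: cramer)
  qed
  show ?thesis
    by (cases p) (auto simp: adj_map_nth intro!: holo_on_sum holo_on_mult holo_on_coord inv)
qed

text \<open>The entries of \<open>A G = G L\<close>: the columns of \<open>G\<close> are eigenvectors of \<open>A\<close>.\<close>
lemma adj_map_Gmat:
  fixes x :: "complex ^ (('n::finite \<times> 'n) + 'n)"
  assumes "x \<in> GL_hss"
  shows "(\<Sum>e\<in>UNIV. adj_map x $ (a, e) * x $ Inl (e, c)) = x $ Inl (a, c) * x $ Inr c"
proof -
  have "(\<Sum>e\<in>UNIV. adj_map x $ (a, e) * x $ Inl (e, c)) =
      (\<Sum>k\<in>UNIV. \<Sum>e\<in>UNIV. x $ Inl (a, k) * x $ Inr k * (matrix_inv (Gmat x) $ k $ e * x $ Inl (e, c)))"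
    by (subst sum.swap) (simp add: adj_map_nth sum_distrib_right mult.assoc)
  also have "\<dots> = x $ Inl (a, c) * x $ Inr c"
    by (simp add: sum_distrib_left[symmetric] Gmat_inverse_sum[OF assms] delta_simps)
  finally show ?thesis .
qed

text \<open>Since \<open>A\<close> is known to be holomorphic, its derivative is obtained from \<open>A G = G L\<close>, which holds on an
open set, by differentiating both sides and multiplying with \<open>G\<^sup>-\<^sup>1\<close>; this avoids differentiating the
inverse.\<close>
lemma adj_map_has_cderiv:
  fixes x :: "complex ^ (('n::finite \<times> 'n) + 'n)"
  assumes x: "x \<in> GL_hss"
  shows "has_cderiv (\<lambda>y. adj_map y $ (a, b))
    (\<lambda>v. \<Sum>c\<in>UNIV. (v $ Inl (a, c) * x $ Inr c + x $ Inl (a, c) * v $ Inr c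
       - (\<Sum>e\<in>UNIV. adj_map x $ (a, e) * v $ Inl (e, c))) * matrix_inv (Gmat x) $ c $ b) x"
proof -
  define D where "D e v = (\<Sum>i\<in>UNIV. cpartial i (\<lambda>y. adj_map y $ (a, e)) x * v $ i)" for e v
  have D: "has_cderiv (\<lambda>y. adj_map y $ (a, e)) (D e) x" for e
    unfolding D_def using holo_on_has_cderiv[OF holo_on_adj_map x] .
  have eq: "(\<Sum>e\<in>UNIV. D e v * x $ Inl (e, c)) = v $ Inl (a, c) * x $ Inr c + x $ Inl (a, c) * v $ Inr c
       - (\<Sum>e\<in>UNIV. adj_map x $ (a, e) * v $ Inl (e, c))" for c v
  proof -
    have "has_cderiv (\<lambda>y. \<Sum>e\<in>UNIV. adj_map y $ (a, e) * y $ Inl (e, c))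
        (\<lambda>v. \<Sum>e\<in>UNIV. adj_map x $ (a, e) * v $ Inl (e, c) + D e v * x $ Inl (e, c)) x"
      by (intro has_cderiv_sum has_cderiv_mult D has_cderiv_coord)
    then have "has_cderiv (\<lambda>y. y $ Inl (a, c) * y $ Inr c)
        (\<lambda>v. \<Sum>e\<in>UNIV. adj_map x $ (a, e) * v $ Inl (e, c) + D e v * x $ Inl (e, c)) x"
      by (rule has_cderiv_transform[OF _ open_GL_hss x]) (rule adj_map_Gmat)
    from has_cderiv_unique[OF this has_cderiv_mult[OF has_cderiv_coord has_cderiv_coord], of v]
    show ?thesis by (simp add: sum.distrib algebra_simps)
  qed
  have "D b v = (\<Sum>c\<in>UNIV. (\<Sum>e\<in>UNIV. D e v * x $ Inl (e, c)) * matrix_inv (Gmat x) $ c $ b)" for v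
  proof -
    have "(\<Sum>c\<in>UNIV. (\<Sum>e\<in>UNIV. D e v * x $ Inl (e, c)) * matrix_inv (Gmat x) $ c $ b)
      = (\<Sum>e\<in>UNIV. \<Sum>c\<in>UNIV. D e v * (x $ Inl (e, c) * matrix_inv (Gmat x) $ c $ b))"
      by (subst sum.swap) (simp add: sum_distrib_right mult.assoc)
    also have "\<dots> = D b v"
      by (simp add: sum_distrib_left[symmetric] Gmat_inverse_sum[OF x] delta_simps)
    finally show ?thesis by simp
  qed
  then have "D b = (\<lambda>v. \<Sum>c\<in>UNIV. (v $ Inl (a, c) * x $ Inr c + x $ Inl (a, c) * v $ Inr c
       - (\<Sum>e\<in>UNIV. adj_map x $ (a, e) * v $ Inl (e, c))) * matrix_inv (Gmat x) $ c $ b)"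
    by (simp add: fun_eq_iff eq)
  with D[of b] show ?thesis by simp
qed

text \<open>Antisymmetry replaces the sum over the partial derivatives of \<open>f\<close> by one directional derivative.\<close>
lemma ham_nth:
  assumes "has_cderiv f D x" and "\<And>i j. \<pi> x $ i $ j = - \<pi> x $ j $ i"
  shows "ham \<pi> f x $ k = - D (\<pi> x $ k)"
proof -
  have "ham \<pi> f x $ k = (\<Sum>i\<in>UNIV. cpartial i f x * \<pi> x $ i $ k)"
    by (simp add: ham_def)
  also have "\<dots> = - (\<Sum>i\<in>UNIV. cpartial i f x * \<pi> x $ k $ i)"
    by (subst assms(2)) (simp add: sum_negf)
  finally show ?thesis by (simp add: has_cderiv_expand[OF assms(1)])
qed

text \<open>The Hamiltonian vector field of \<open>A\<^sub>a\<^sub>b\<close> is the infinitesimal left multiplication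
\<open>(G, L) \<mapsto> (E\<^sub>b\<^sub>a G, 0)\<close>.\<close>
lemma ham_adj_map:
  fixes x :: "complex ^ (('n::finite \<times> 'n) + 'n)"
  assumes x: "x \<in> GL_hss"
  shows "ham GL_hss_bivector (\<lambda>y. adj_map y $ (a, b)) x $ Inl (c, l) = (if c = b then x $ Inl (a, l) else 0)"
    and "ham GL_hss_bivector (\<lambda>y. adj_map y $ (a, b)) x $ Inr l = 0"
proof -
  let ?N = "matrix_inv (Gmat x)"
  have antisym: "GL_hss_bivector x $ p $ q = - GL_hss_bivector x $ q $ p" for p q
    using poisson_structure_GL_hss x unfolding poisson_structure_def by blast
  have H: "ham GL_hss_bivector (\<lambda>y. adj_map y $ (a, b)) x $ p =
    - (\<Sum>j\<in>UNIV. (GL_hss_bivector x $ p $ Inl (a, j) * x $ Inr j + x $ Inl (a, j) * GL_hss_bivector x $ p $ Inr j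
       - (\<Sum>e\<in>UNIV. adj_map x $ (a, e) * GL_hss_bivector x $ p $ Inl (e, j))) * ?N $ j $ b)" for p
    by (rule ham_nth[of _ _ x GL_hss_bivector, OF adj_map_has_cderiv[OF x] antisym])
  \<comment> \<open>For \<open>j \<noteq> l\<close> the brackets between entries of \<open>G\<close> contribute, for \<open>j = l\<close> those of \<open>G\<close> with \<open>\<lambda>\<^sub>l\<close>; the
    outcome is the same, which completes the sum over \<open>j\<close> to an entry of \<open>G G\<^sup>-\<^sup>1\<close>.\<close>
  have L: "GL_hss_bivector x $ Inl (c, l) $ Inl (a, j) * x $ Inr j + x $ Inl (a, j) * GL_hss_bivector x $ Inl (c, l) $ Inr j
       - (\<Sum>e\<in>UNIV. adj_map x $ (a, e) * GL_hss_bivector x $ Inl (c, l) $ Inl (e, j))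
       = - (x $ Inl (a, l) * x $ Inl (c, j))" for j
  proof (cases "j = l")
    case False
    then have ne: "x $ Inr l - x $ Inr j \<noteq> 0" using GL_hss_distinct[OF x] by fastforce
    define K where "K = x $ Inl (c, j) / (x $ Inr l - x $ Inr j)"
    have K: "K * (x $ Inr l - x $ Inr j) = x $ Inl (c, j)"
      using ne by (simp add: K_def)
    have row: "GL_hss_bivector x $ Inl (c, l) $ Inl (e, j) = x $ Inl (e, l) * K" for e
      using False by (simp add: GL_hss_bivector_nth K_def mult.commute)
    have "(\<Sum>e\<in>UNIV. adj_map x $ (a, e) * (x $ Inl (e, l) * K)) = x $ Inl (a, l) * x $ Inr l * K"
      by (simp add: adj_map_Gmat[OF x, symmetric] sum_distrib_right mult.assoc)
    then show ?thesis
      using False by (simp add: row GL_hss_bivector_nth(2) K[symmetric] algebra_simps)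
  qed (simp add: GL_hss_bivector_nth)
  show "ham GL_hss_bivector (\<lambda>y. adj_map y $ (a, b)) x $ Inl (c, l) = (if c = b then x $ Inl (a, l) else 0)"
    unfolding H L using Gmat_inverse_sum(1)[OF x, of c b]
    by (simp add: sum_negf mult.assoc sum_distrib_left[symmetric])
  have "GL_hss_bivector x $ Inr l $ Inl (a, j) * x $ Inr j + x $ Inl (a, j) * GL_hss_bivector x $ Inr l $ Inr j
       - (\<Sum>e\<in>UNIV. adj_map x $ (a, e) * GL_hss_bivector x $ Inr l $ Inl (e, j)) = 0" for j
    by (cases "j = l") (auto simp: GL_hss_bivector_nth adj_map_Gmat[OF x])
  then show "ham GL_hss_bivector (\<lambda>y. adj_map y $ (a, b)) x $ Inr l = 0"
    unfolding H by simp
qed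

lemma pbracket_adj_map:
  fixes x :: "complex ^ (('n::finite \<times> 'n) + 'n)"
  assumes x: "x \<in> GL_hss"
  shows "pbracket GL_hss_bivector (\<lambda>y. adj_map y $ p) (\<lambda>y. adj_map y $ q) x = kk_bivector (adj_map x) $ p $ q"
proof -
  obtain a b c d where pq: "p = (a, b)" "q = (c, d)" by (cases p, cases q) auto
  let ?N = "matrix_inv (Gmat x)"
  have "pbracket GL_hss_bivector (\<lambda>y. adj_map y $ p) (\<lambda>y. adj_map y $ q) x =
    (\<Sum>j\<in>UNIV. ((if c = b then x $ Inl (a, j) else 0) * x $ Inr j - adj_map x $ (c, b) * x $ Inl (a, j)) * ?N $ j $ d)"
    unfolding pq pbracket_ham[OF adj_map_has_cderiv[OF x]] by (simp add: ham_adj_map[OF x] delta_simps)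
  also have "\<dots> = (if b = c then (\<Sum>j\<in>UNIV. x $ Inl (a, j) * x $ Inr j * ?N $ j $ d) else 0)
      - adj_map x $ (c, b) * (\<Sum>j\<in>UNIV. x $ Inl (a, j) * ?N $ j $ d)"
    by (simp add: left_diff_distrib sum_subtractf sum_distrib_left mult.assoc)
  also have "\<dots> = kk_bivector (adj_map x) $ p $ q"
    by (simp add: pq kk_bivector_nth adj_map_nth[symmetric] Gmat_inverse_sum[OF x])
  finally show ?thesis .
qed

theorem theorem2p1:
  shows "(\<exists>!\<kappa> :: ('n::finite \<times> 'n) bivector. kirillov_kostant \<kappa>) \<and>
    (\<forall>\<kappa> :: ('n \<times> 'n) bivector. kirillov_kostant \<kappa> \<longrightarrow>
       poisson_morphism (GL_hss :: (complex ^ (('n \<times> 'n) + 'n)) set) GL_hss_bivector UNIV \<kappa> adj_map) \<and>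
    (\<forall>\<kappa> :: ('n \<times> 'n) bivector. kirillov_kostant \<kappa> \<longleftrightarrow>
       (\<forall>a. tensor_bracket \<kappa> mat_of mat_of a = commutator (kron (mat_of a) (mat 1)) Pmat)) \<and>
    (\<forall>x \<in> (GL_hss :: (complex ^ (('n \<times> 'n) + 'n)) set).
       tensor_bracket GL_hss_bivector (mat_of \<circ> adj_map) (mat_of \<circ> adj_map) x
       = commutator (kron (mat_of (adj_map x)) (mat 1)) Pmat)"
proof (intro conjI allI ballI impI)
  show "\<exists>!\<kappa> :: ('n \<times> 'n) bivector. kirillov_kostant \<kappa>"
    by (simp add: kirillov_kostant_iff)
  show "poisson_morphism (GL_hss :: (complex ^ (('n \<times> 'n) + 'n)) set) GL_hss_bivector UNIV \<kappa> adj_map"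
    if "kirillov_kostant \<kappa>" for \<kappa>
    using that poisson_structure_GL_hss poisson_structure_kk
    by (intro poisson_morphismI holo_on_adj_map)
       (auto simp: kirillov_kostant_iff pbracket_adj_map)
  show "kirillov_kostant \<kappa> \<longleftrightarrow>
      (\<forall>a. tensor_bracket \<kappa> mat_of mat_of a = commutator (kron (mat_of a) (mat 1)) Pmat)"
    for \<kappa> :: "('n \<times> 'n) bivector"
    unfolding kirillov_kostant_iff tensor_bracket_iff
    by (auto simp: mat_of_def pbracket_coord fun_eq_iff vec_eq_iff)
  show "tensor_bracket GL_hss_bivector (mat_of \<circ> adj_map) (mat_of \<circ> adj_map) x
       = commutator (kron (mat_of (adj_map x)) (mat 1)) Pmat"
    if "x \<in> GL_hss" for x :: "complex ^ (('n \<times> 'n) + 'n)"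
    unfolding tensor_bracket_iff using pbracket_adj_map[OF that] by (simp add: mat_of_def)
qed

end
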